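(* Consider the following setting. - The signal $g=\{g(\varphi)\}_{\varphi\in\mathcal S}\in\mathcal S'$ to be recovered is a realization of a generalized Gaussian process $G\sim\mathcal N(0,\mathrm A)$ in $\mathcal S'$. - There exists an invertible whitening/regularization operator $\mathrm L$ such that $\mathrm A=(\mathrm L^\ast\mathrm L)^{-1}:\mathcal S\to\mathcal S'$ is positive-definite. This operator induces a native Hilbert space $\mathcal H=\{f\in\mathcal S':\|\mathrm Lf\|_{L_2}<\infty\}$ whose continuous dual $\mathcal H'$ is equipped with the inner product $\langle\nu_1,\nu_2\rangle_{\mathcal H'}=\langle\mathrm A\nu_1,\nu_2\rangle$. - The observed data are $\mathbf y=\boldsymbol\nu(g)+\boldsymbol\epsilon\in\mathbb R^M$, with $\boldsymbol\nu=(\nu_1,\dots,\nu_M)\in(\mathcal H')^M$ and $\boldsymbol\epsilon$ a realization of a white Gaussian noise with variance $\sigma^2$. Then, for any $\varphi\in\mathcal H'\supset\mathcal S$, the MMSE estimator of $g(\varphi)$ given $\mathbf y$ is $$g_{\mathrm{MMSE}}(\varphi|\mathbf y)=\mathbb E\{G(\varphi)|\mathbf y\}=g_\lambda(\varphi)\quad\text{with}\quad\lambda=\sigma^2,$$ where $g_\lambda\in\mathcal H$ is the generalized smoothing spline defined by $$g_\lambda=\arg\min_{g\in\mathcal H}\left(\|\mathbf y-\boldsymbol\nu(g)\|_2^2+\lambda\|\mathrm Lg\|_{L_2}^2\right)=\sum_{m=1}^Ma_m\,\mathrm A\{\nu_m\},\qquad(a_m)=(\mathbf G+\lambda\mathbf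 I)^{-1}\mathbf y,$$ with $\mathbf G\in\mathbb R^{M\times M}$ given by $[\mathbf G]_{m,n}=\langle\mathrm A\nu_m,\nu_n\rangle=\langle\nu_m,\nu_n\rangle_{\mathcal H'}$.
   Context: All vector spaces are real. $(\mathcal S,\mathcal S')$ is a dual pair of complete nuclear spaces, which are reflexive ($\mathcal S''=\mathcal S$), with $\mathcal S$ canonically, continuously and densely embedded in $\mathcal S'$. $\langle\cdot,\cdot\rangle$ is the duality product, used with either order of arguments and extended by continuity to dual pairs of Hilbert spaces lying between $\mathcal S$ and $\mathcal S'$. The pivot space $L_2$ is the completion of $\mathcal S$ in the norm $\|\varphi\|_2=\sqrt{\langle\varphi,\varphi\rangle}$, identified with its own dual. An operator $\mathrm L:\mathcal S\to L_2$ is invertible here if it is admissible with trivial null space: there is an inverse $\mathrm L^{-1}$ with $\mathrm L^{-1}\mathrm L\varphi=\mathrm L\mathrm L^{-1}\varphi=\varphi$ for all $\varphi\in\mathcal S$, and its Gram operator $\mathrm A=(\mathrm L^\ast\mathrm L)^{-1}=\mathrm L^{-1}\mathrm L^{-1\ast}:\mathcal S\to\mathcal S'$ is continuous and positive-definite ($\langle\mathrm A\varphi,\varphi\rangle>0$ for $\varphi\in\mathcal S\setminus\{0\}$). Then $\mathrm L$ extends to an isometric bijection $\mathcal H=\overline{(\mathcal S,\|\mathrm L\cdot\|_{L_2})}\to L_2$, so that $\mathcal H=\mathrm L^{-1}(L_2)$ with norm $\|\mathrm L\cdot\|_{L_2}$; its dual is $\mathcal H'=\overline{(\mathcal S,\|\cdot\|_{\mathcal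 H'})}$ with $\|\varphi\|_{\mathcal H'}^2=\langle\mathrm A\varphi,\varphi\rangle$, and $\mathrm A$ extends to the Riesz map $\mathcal H'\to\mathcal H$. A generalized Gaussian process $G\sim\mathcal N(0,\mathrm A)$ in $\mathcal S'$ is a random continuous linear functional on $\mathcal S$ (with realizations in $\mathcal S'$) for which every vector $(G(\varphi_1),\dots,G(\varphi_N))$, $\varphi_n\in\mathcal S$, is Gaussian with zero mean and covariance matrix $[\langle\mathrm A\varphi_m,\varphi_n\rangle]_{m,n}$; its characteristic functional is $\mathbb E\{\mathrm e^{\mathrm iG(\varphi)}\}=\exp(-\tfrac12\langle\mathrm A\varphi,\varphi\rangle)=\exp(-\tfrac12\|\varphi\|_{\mathcal H'}^2)$. The action of $G$ is extended from $\mathcal S$ to all $\nu\in\mathcal H'$ by continuity/density, with the same formulas for the characteristic functional and the finite-dimensional Gaussian laws. The measurement model is understood probabilistically as $\boldsymbol Y=(G(\nu_1),\dots,G(\nu_M))+\boldsymbol\epsilon$, where $\boldsymbol\epsilon\sim\mathcal N(\boldsymbol0,\sigma^2\mathbf I)$ is independent of $G$; $\mathbf y$ is the observed value of $\boldsymbol Y$, and $\mathbb E\{\cdot|\mathbf y\}$ means $\mathbb E\{\cdot|\boldsymbol Y=\mathbf y\}$. The $\nu_m$ are assumed to be linearly independent. For $f\in\mathcal H$, $\boldsymbol\nu(f)=(\langle\nu_1,f\rangle,\dots,\langle\nu_M,f\rangle)$, and for $\varphi\in\mathcal H'$, $f(\varphi)=\langle f,\varphi\rangle$. The MMSE estimator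 of a random variable $X$ given $\boldsymbol Y$ is the function of $\boldsymbol Y$ that minimizes the mean-square error. *)

theory Defs
  imports "HOL-Probability.Probability"
begin

section \<open>Locally convex and nuclear spaces\<close>

definition locally_convex_space :: "'a::{real_vector,topological_ab_group_add,t2_space} itself \<Rightarrow> bool" where
  "locally_convex_space _ \<longleftrightarrow>
     continuous_on UNIV (\<lambda>(c::real, x::'a). c *\<^sub>R x) \<and>
     (\<forall>U::'a set. open U \<and> 0 \<in> U \<longrightarrow> (\<exists>V. open V \<and> convex V \<and> 0 \<in> V \<and> V \<subseteq> U))"

definition cauchy_filter_tvs :: "'a::{real_vector,topological_ab_group_add,t2_space} filter \<Rightarrow> bool" where
  "cauchy_filter_tvs F \<longleftrightarrow> F \<noteq> bot \<and>
     (\<forall>U. open U \<and> 0 \<in> U \<longrightarrow> (\<exists>B. eventually (\<lambda>x. x \<in> B) F \<and> (\<forall>x\<in>B. \<forall>y\<in>B. x - y \<in> U)))"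

definition complete_tvs :: "'a::{real_vector,topological_ab_group_add,t2_space} itself \<Rightarrow> bool" where
  "complete_tvs _ \<longleftrightarrow> (\<forall>F::'a filter. cauchy_filter_tvs F \<longrightarrow> (\<exists>x. F \<le> nhds x))"

definition continuous_seminorm :: "('a::{real_vector,topological_ab_group_add,t2_space} \<Rightarrow> real) \<Rightarrow> bool" where
  "continuous_seminorm p \<longleftrightarrow>
     (\<forall>x y. p (x + y) \<le> p x + p y) \<and> (\<forall>c x. p (c *\<^sub>R x) = \<bar>c\<bar> * p x) \<and> continuous_on UNIV p"

text \<open>
  Grothendieck's definition: for every continuous seminorm \<open>p\<close> there is a continuous seminorm \<open>q\<close>
  for which the canonical map from the space normed by \<open>q\<close> to the completion of the space
  normed by \<open>p\<close> is nuclear.  In the nuclear representation \<open>\<Sum>n. f n \<otimes> y n\<close> the vectors \<open>y n\<close>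
  are taken in the space itself instead of its completion. This is no restriction, because a
  point of the completion is the sum of an absolutely convergent series of points of the space.
\<close>

definition nuclear_space :: "'a::{real_vector,topological_ab_group_add,t2_space} itself \<Rightarrow> bool" where
  "nuclear_space _ \<longleftrightarrow> locally_convex_space TYPE('a) \<and>
     (\<forall>p::'a \<Rightarrow> real. continuous_seminorm p \<longrightarrow>
       (\<exists>q (a::nat \<Rightarrow> real) (f::nat \<Rightarrow> 'a \<Rightarrow> real) (y::nat \<Rightarrow> 'a).
          continuous_seminorm q \<and> summable a \<and>
          (\<forall>n. 0 \<le> a n \<and> linear (f n) \<and> (\<forall>x. \<bar>f n x\<bar> \<le> a n * q x) \<and> p (y n) \<le> 1) \<and>
          (\<forall>x. (\<lambda>N. p (x - (\<Sum>n<N. f n x *\<^sub>R y n))) \<longlonglongrightarrow> 0)))"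


section \<open>Dual pairs\<close>

definition bounded_tvs :: "'a::{real_vector,topological_ab_group_add,t2_space} set \<Rightarrow> bool" where
  "bounded_tvs B \<longleftrightarrow>
     (\<forall>U. open U \<and> 0 \<in> U \<longrightarrow> (\<exists>s>0. \<forall>t>s. B \<subseteq> (\<lambda>x. t *\<^sub>R x) ` U))"

text \<open>
  \<open>strong_dual pr\<close>: through the pairing \<open>pr\<close>, the type \<open>'b\<close> is the space of all continuous linear
  functionals on \<open>'a\<close> with the strong dual topology (the polars of the bounded sets form a base
  of neighbourhoods of the origin).
\<close>

definition strong_dual ::
  "('b::{real_vector,topological_ab_group_add,t2_space} \<Rightarrow> 'a::{real_vector,topological_ab_group_add,t2_space} \<Rightarrow> real) \<Rightarrow> bool" where
  "strong_dual pr \<longleftrightarrow> bilinear pr \<and>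
     bij_betw pr UNIV {l. linear l \<and> continuous_on UNIV l} \<and>
     (\<forall>P. eventually P (nhds 0) \<longleftrightarrow>
        (\<exists>B. bounded_tvs B \<and> (\<forall>u. (\<forall>x\<in>B. \<bar>pr u x\<bar> \<le> 1) \<longrightarrow> P u)))"

text \<open>
  \<open>'s\<close> is \<open>\<S>\<close>, \<open>'d\<close> is \<open>\<S>'\<close>, \<open>pr u \<phi>\<close> is \<open>\<langle>u, \<phi>\<rangle>\<close> and \<open>emb\<close> is the canonical embedding of \<open>\<S>\<close>
  into \<open>\<S>'\<close>, so that \<open>\<langle>\<phi>, \<psi>\<rangle>\<close> is \<open>pr (emb \<phi>) \<psi>\<close> for \<open>\<phi>, \<psi> \<in> \<S>\<close>.
\<close>

definition nuclear_dual_pair ::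
  "('d::{real_vector,topological_ab_group_add,t2_space} \<Rightarrow> 's::{real_vector,topological_ab_group_add,t2_space} \<Rightarrow> real) \<Rightarrow> ('s \<Rightarrow> 'd) \<Rightarrow> bool" where
  "nuclear_dual_pair pr emb \<longleftrightarrow>
     nuclear_space TYPE('s) \<and> complete_tvs TYPE('s) \<and>
     nuclear_space TYPE('d) \<and> complete_tvs TYPE('d) \<and>
     strong_dual pr \<and> strong_dual (\<lambda>\<phi> u. pr u \<phi>) \<and>
     linear emb \<and> inj emb \<and> continuous_on UNIV emb \<and> closure (range emb) = UNIV \<and>
     (\<forall>\<phi> \<psi>. pr (emb \<phi>) \<psi> = pr (emb \<psi>) \<phi>) \<and>
     (\<forall>\<phi>. \<phi> \<noteq> 0 \<longrightarrow> pr (emb \<phi>) \<phi> > 0)"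

text \<open>The Hilbert space \<open>'l\<close> with the dense map \<open>j\<close> is the completion of \<open>\<S>\<close> for \<open>\<langle>\<phi>, \<psi>\<rangle>\<close>.\<close>

definition pivot_space ::
  "('d \<Rightarrow> 's::real_vector \<Rightarrow> real) \<Rightarrow> ('s \<Rightarrow> 'd) \<Rightarrow> ('s \<Rightarrow> 'l::{real_inner,complete_space}) \<Rightarrow> bool" where
  "pivot_space pr emb j \<longleftrightarrow>
     linear j \<and> (\<forall>\<phi> \<psi>. inner (j \<phi>) (j \<psi>) = pr (emb \<phi>) \<psi>) \<and> closure (range j) = UNIV"


section \<open>Whitening operator, native space and its dual\<close>

text \<open>The extension of \<open>L\<close> by continuity, as the closure of its graph in \<open>\<S>' \<times> L\<^sub>2\<close>.\<close>

definition ext_graph ::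
  "('s \<Rightarrow> 'd::topological_space) \<Rightarrow> ('s \<Rightarrow> 'l::topological_space) \<Rightarrow> ('d \<times> 'l) set" where
  "ext_graph emb L = closure (range (\<lambda>\<phi>. (emb \<phi>, L \<phi>)))"

definition native_space ::
  "('s \<Rightarrow> 'd::topological_space) \<Rightarrow> ('s \<Rightarrow> 'l::topological_space) \<Rightarrow> 'd set" where
  "native_space emb L = Domain (ext_graph emb L)"

definition ext_op ::
  "('s \<Rightarrow> 'd::topological_space) \<Rightarrow> ('s \<Rightarrow> 'l::topological_space) \<Rightarrow> 'd \<Rightarrow> 'l" where
  "ext_op emb L f = (THE w. (f, w) \<in> ext_graph emb L)"

text \<open>The adjoint \<open>L\<^sup>-\<^sup>1\<^sup>* : \<S> \<rightarrow> L\<^sub>2\<close> of \<open>L\<^sup>-\<^sup>1 : L\<^sub>2 \<rightarrow> \<S>'\<close>.\<close>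

definition inv_adjoint ::
  "('d \<Rightarrow> 's \<Rightarrow> real) \<Rightarrow> ('l::real_inner \<Rightarrow> 'd) \<Rightarrow> 's \<Rightarrow> 'l" where
  "inv_adjoint pr Linv \<phi> = (THE v. \<forall>w. inner v w = pr (Linv w) \<phi>)"

definition gram_op ::
  "('d \<Rightarrow> 's \<Rightarrow> real) \<Rightarrow> ('l::real_inner \<Rightarrow> 'd) \<Rightarrow> 's \<Rightarrow> 'd" where
  "gram_op pr Linv \<phi> = Linv (inv_adjoint pr Linv \<phi>)"

text \<open>
  \<open>L\<^sup>-\<^sup>1\<close> takes its values in \<open>\<S>'\<close>, so that \<open>L\<close> in \<open>L L\<^sup>-\<^sup>1 \<phi> = \<phi>\<close> is its extension, which has to be
  well defined (single-valued).
\<close>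

definition invertible_operator ::
  "('d::{real_vector,topological_ab_group_add,t2_space} \<Rightarrow> 's::{real_vector,topological_ab_group_add,t2_space} \<Rightarrow> real)
   \<Rightarrow> ('s \<Rightarrow> 'd) \<Rightarrow> ('s \<Rightarrow> 'l::{real_inner,complete_space}) \<Rightarrow> ('s \<Rightarrow> 'l) \<Rightarrow> ('l \<Rightarrow> 'd) \<Rightarrow> bool" where
  "invertible_operator pr emb j L Linv \<longleftrightarrow>
     linear L \<and> continuous_on UNIV L \<and> single_valued (ext_graph emb L) \<and>
     linear Linv \<and> continuous_on UNIV Linv \<and>
     (\<forall>\<phi>. Linv (L \<phi>) = emb \<phi>) \<and>
     (\<forall>\<phi>. Linv (j \<phi>) \<in> native_space emb L \<and> ext_op emb L (Linv (j \<phi>)) = j \<phi>) \<and>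
     continuous_on UNIV (gram_op pr Linv) \<and>
     (\<forall>\<phi>. \<phi> \<noteq> 0 \<longrightarrow> pr (gram_op pr Linv \<phi>) \<phi> > 0)"

text \<open>
  The continuous dual of the native space \<open>\<H>\<close>.  As \<open>\<S>\<close> is dense in \<open>\<H>\<close>, a continuous functional on \<open>\<H>\<close>
  is determined by its restriction to \<open>\<S>\<close>, and these restrictions are the \<open>\<nu> \<in> \<S>'\<close> that are bounded
  for the norm \<open>norm (L \<phi>)\<close>.
\<close>

definition native_dual ::
  "('d \<Rightarrow> 's \<Rightarrow> real) \<Rightarrow> ('s \<Rightarrow> 'l::real_normed_vector) \<Rightarrow> 'd set" where
  "native_dual pr L = {\<nu>. \<exists>C. \<forall>\<phi>. \<bar>pr \<nu> \<phi>\<bar> \<le> C * norm (L \<phi>)}"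

definition native_dual_norm ::
  "('d \<Rightarrow> 's \<Rightarrow> real) \<Rightarrow> ('s \<Rightarrow> 'l::real_normed_vector) \<Rightarrow> 'd \<Rightarrow> real" where
  "native_dual_norm pr L \<nu> = Sup {\<bar>pr \<nu> \<phi>\<bar> |\<phi>. norm (L \<phi>) \<le> 1}"

text \<open>The filter on \<open>\<S>\<close> that describes \<open>\<phi> \<rightarrow> \<nu>\<close> in \<open>\<H>'\<close>, used for extensions by continuity.\<close>

definition to_dual ::
  "('d \<Rightarrow> 's \<Rightarrow> real) \<Rightarrow> ('s \<Rightarrow> 'd::real_vector) \<Rightarrow> ('s \<Rightarrow> 'l::real_normed_vector) \<Rightarrow> 'd \<Rightarrow> 's filter" where
  "to_dual pr emb L \<nu> = filtercomap (\<lambda>\<phi>. native_dual_norm pr L (emb \<phi> - \<nu>)) (nhds 0)"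

text \<open>\<open>\<langle>\<nu>, f\<rangle>\<close> for \<open>\<nu> \<in> \<H>'\<close> and \<open>f \<in> \<H>\<close>: the limit of \<open>\<langle>\<nu>, \<phi>\<rangle>\<close> as \<open>\<phi> \<in> \<S>\<close> tends to \<open>f\<close> in \<open>\<H>\<close>.\<close>

definition native_pairing ::
  "('d \<Rightarrow> 's \<Rightarrow> real) \<Rightarrow> ('s \<Rightarrow> 'd::topological_space) \<Rightarrow> ('s \<Rightarrow> 'l::real_normed_vector) \<Rightarrow> 'd \<Rightarrow> 'd \<Rightarrow> real" where
  "native_pairing pr emb L \<nu> f = Lim (filtercomap L (nhds (ext_op emb L f))) (pr \<nu>)"

definition ext_gram ::
  "('d \<Rightarrow> 's \<Rightarrow> real) \<Rightarrow> ('s \<Rightarrow> 'd::{real_vector,t2_space}) \<Rightarrow> ('s \<Rightarrow> 'l::real_normed_vector)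
   \<Rightarrow> ('s \<Rightarrow> 'd) \<Rightarrow> 'd \<Rightarrow> 'd" where
  "ext_gram pr emb L A \<nu> = Lim (to_dual pr emb L \<nu>) A"

definition native_dual_inner ::
  "('d \<Rightarrow> 's \<Rightarrow> real) \<Rightarrow> ('s \<Rightarrow> 'd::{real_vector,t2_space}) \<Rightarrow> ('s \<Rightarrow> 'l::real_normed_vector)
   \<Rightarrow> ('s \<Rightarrow> 'd) \<Rightarrow> 'd \<Rightarrow> 'd \<Rightarrow> real" where
  "native_dual_inner pr emb L A \<nu>1 \<nu>2 = native_pairing pr emb L \<nu>2 (ext_gram pr emb L A \<nu>1)"


section \<open>Smoothing splines\<close>

definition measure_vec ::
  "('d \<Rightarrow> 's \<Rightarrow> real) \<Rightarrow> ('s \<Rightarrow> 'd::topological_space) \<Rightarrow> ('s \<Rightarrow> 'l::real_normed_vector)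
   \<Rightarrow> ('m::finite \<Rightarrow> 'd) \<Rightarrow> 'd \<Rightarrow> real ^ 'm" where
  "measure_vec pr emb L \<nu> g = (\<chi> m. native_pairing pr emb L (\<nu> m) g)"

definition spline_cost ::
  "('d \<Rightarrow> 's \<Rightarrow> real) \<Rightarrow> ('s \<Rightarrow> 'd::topological_space) \<Rightarrow> ('s \<Rightarrow> 'l::real_normed_vector)
   \<Rightarrow> ('m::finite \<Rightarrow> 'd) \<Rightarrow> real \<Rightarrow> real ^ 'm \<Rightarrow> 'd \<Rightarrow> real" where
  "spline_cost pr emb L \<nu> lam y g =
     (norm (y - measure_vec pr emb L \<nu> g))\<^sup>2 + lam * (norm (ext_op emb L g))\<^sup>2"

definition smoothing_spline ::
  "('d \<Rightarrow> 's \<Rightarrow> real) \<Rightarrow> ('s \<Rightarrow> 'd::topological_space) \<Rightarrow> ('s \<Rightarrow> 'l::real_normed_vector)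
   \<Rightarrow> ('m::finite \<Rightarrow> 'd) \<Rightarrow> real \<Rightarrow> real ^ 'm \<Rightarrow> 'd" where
  "smoothing_spline pr emb L \<nu> lam y =
     arg_min (spline_cost pr emb L \<nu> lam y) (\<lambda>g. g \<in> native_space emb L)"

definition gram_matrix ::
  "('d \<Rightarrow> 's \<Rightarrow> real) \<Rightarrow> ('s \<Rightarrow> 'd::{real_vector,t2_space}) \<Rightarrow> ('s \<Rightarrow> 'l::real_normed_vector)
   \<Rightarrow> ('s \<Rightarrow> 'd) \<Rightarrow> ('m::finite \<Rightarrow> 'd) \<Rightarrow> real ^ 'm ^ 'm" where
  "gram_matrix pr emb L A \<nu> = (\<chi> m n. native_dual_inner pr emb L A (\<nu> m) (\<nu> n))"


section \<open>Gaussian vectors and generalized Gaussian processes\<close>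

definition centered_gaussian :: "real \<Rightarrow> real measure" where
  "centered_gaussian v = (if v = 0 then return borel 0 else density lborel (normal_density 0 (sqrt v)))"

text \<open>
  Possibly degenerate zero-mean Gaussian vectors: every linear combination of the components is
  Gaussian with the variance prescribed by the covariance matrix \<open>C\<close>.
\<close>

definition gaussian_vector :: "'w measure \<Rightarrow> 'i set \<Rightarrow> ('i \<Rightarrow> 'w \<Rightarrow> real) \<Rightarrow> ('i \<Rightarrow> 'i \<Rightarrow> real) \<Rightarrow> bool" where
  "gaussian_vector M I X C \<longleftrightarrow>
     (\<forall>i\<in>I. X i \<in> borel_measurable M) \<and>
     (\<forall>t. 0 \<le> (\<Sum>i\<in>I. \<Sum>k\<in>I. t i * t k * C i k) \<and>
          distr M borel (\<lambda>\<omega>. \<Sum>i\<in>I. t i * X i \<omega>) =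
            centered_gaussian (\<Sum>i\<in>I. \<Sum>k\<in>I. t i * t k * C i k))"

definition cylinder_algebra :: "('d \<Rightarrow> 's \<Rightarrow> real) \<Rightarrow> 'd measure" where
  "cylinder_algebra pr = vimage_algebra UNIV pr (PiM UNIV (\<lambda>_. borel))"

definition gaussian_process ::
  "'w measure \<Rightarrow> ('d \<Rightarrow> 's \<Rightarrow> real) \<Rightarrow> ('s \<Rightarrow> 'd) \<Rightarrow> ('w \<Rightarrow> 'd) \<Rightarrow> bool" where
  "gaussian_process M pr A G \<longleftrightarrow>
     prob_space M \<and> G \<in> measurable M (cylinder_algebra pr) \<and>
     (\<forall>(N::nat) \<phi>. gaussian_vector M {..<N} (\<lambda>n \<omega>. pr (G \<omega>) (\<phi> n)) (\<lambda>m n. pr (A (\<phi> m)) (\<phi> n)))"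

text \<open>
  Extension of \<open>G\<close> to \<open>\<H>'\<close>: \<open>Gext \<nu>\<close> is any version of the mean-square limit of \<open>G(\<phi>)\<close> as
  \<open>\<phi> \<rightarrow> \<nu>\<close> in \<open>\<H>'\<close>.
\<close>

definition process_extension ::
  "'w measure \<Rightarrow> ('d \<Rightarrow> 's \<Rightarrow> real) \<Rightarrow> ('s \<Rightarrow> 'd::real_vector) \<Rightarrow> ('s \<Rightarrow> 'l::real_normed_vector)
   \<Rightarrow> ('w \<Rightarrow> 'd) \<Rightarrow> ('d \<Rightarrow> 'w \<Rightarrow> real) \<Rightarrow> bool" where
  "process_extension M pr emb L G Gext \<longleftrightarrow>
     (\<forall>\<nu>\<in>native_dual pr L.
        Gext \<nu> \<in> borel_measurable M \<and> integrable M (\<lambda>\<omega>. (Gext \<nu> \<omega>)\<^sup>2) \<and>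
        ((\<lambda>\<phi>. \<integral>\<omega>. (pr (G \<omega>) \<phi> - Gext \<nu> \<omega>)\<^sup>2 \<partial>M) \<longlongrightarrow> 0) (to_dual pr emb L \<nu>))"


section \<open>Estimators\<close>

text \<open>The mean-square error is a nonnegative integral, so infinite errors are not discarded.\<close>

definition mmse_estimator ::
  "'w measure \<Rightarrow> ('w \<Rightarrow> real) \<Rightarrow> ('w \<Rightarrow> 'y::topological_space) \<Rightarrow> ('y \<Rightarrow> real) \<Rightarrow> bool" where
  "mmse_estimator M X Y T \<longleftrightarrow>
     is_arg_min (\<lambda>T. \<integral>\<^sup>+\<omega>. ennreal ((X \<omega> - T (Y \<omega>))\<^sup>2) \<partial>M) (\<lambda>T. T \<in> borel_measurable borel) T"

text \<open>\<open>T\<close> is a version of the function that maps \<open>y\<close> to the conditional expectation of \<open>X\<close> given \<open>Y = y\<close>.\<close>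

definition cond_exp_given ::
  "'w measure \<Rightarrow> ('w \<Rightarrow> real) \<Rightarrow> ('w \<Rightarrow> 'y::topological_space) \<Rightarrow> ('y \<Rightarrow> real) \<Rightarrow> bool" where
  "cond_exp_given M X Y T \<longleftrightarrow>
     T \<in> borel_measurable borel \<and>
     (AE \<omega> in M. real_cond_exp M (vimage_algebra (space M) Y borel) X \<omega> = T (Y \<omega>))"

end

theory Submission
  imports Defs
begin

text \<open>
  The proof moves the whole problem into the Hilbert space \<open>L\<^sub>2\<close>. Since \<open>L\<close> is an isometry of \<open>\<H>\<close> onto
  \<open>L\<^sub>2\<close>, every \<open>\<nu> \<in> \<H>'\<close> has a representer \<open>v\<close> in \<open>L\<^sub>2\<close>, characterized by \<open>\<langle>\<nu>, \<phi>\<rangle> = inner v (L \<phi>)\<close> on \<open>\<S>\<close>.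
  Then \<open>A \<nu> = L\<^sup>-\<^sup>1 v\<close> and \<open>\<langle>\<nu>, L\<^sup>-\<^sup>1 w\<rangle> = inner v w\<close> (\<open>ext_gram_eq\<close>, \<open>native_pairing_eq\<close>), and \<open>\<G>\<close>, the Gram
  matrix of the \<open>\<nu> m\<close>, is the Gram matrix of their representers \<open>r m\<close>. The smoothing spline is therefore the
  solution of a ridge regression in \<open>L\<^sub>2\<close>, and completing the square (\<open>ridge_cost_expand\<close>) gives its
  existence, its uniqueness and its coefficients.

  For the estimator, let \<open>b m = inner v (r m)\<close> be the covariances of the target \<open>G(\<phi>)\<close> with the
  measurements, \<open>v\<close> being the representer of \<open>\<phi>\<close>, and \<open>c = (\<G> + \<sigma>\<^sup>2 I)\<^sup>-\<^sup>1 b\<close>. As the matrix is symmetric, the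
  value of the spline at \<open>\<phi>\<close> is \<open>inner c y\<close> (\<open>inner_ridge_coeffs\<close>). The characteristic function of
  \<open>a Z + t \<bullet> Y\<close> with the residual \<open>Z = G(\<phi>) - c \<bullet> Y\<close> is known from the Gaussian laws, the mean-square
  extension to \<open>\<H>'\<close> and the independence of the noise (\<open>mean_square_limit_fourier\<close>). The equations for \<open>c\<close>
  remove the mixed term in \<open>a\<close> and \<open>t\<close> from its exponent, so it is even in \<open>a\<close>. Hence
  \<open>sin (a Z)\<close> is orthogonal to all trigonometric functions of \<open>Y\<close>, by uniqueness of the Fourier transform to
  all events of \<open>Y\<close> (\<open>expectation_vimage_eq_0_of_fourier\<close>), and with \<open>a \<rightarrow> 0\<close> the same holds for \<open>Z\<close>. This is
  the characterization of \<open>c \<bullet> Y\<close> as conditional expectation, and Pythagoras makes it the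
  almost surely unique estimator of least mean-square error (\<open>mmse_of_orthogonal_residual\<close>).

  Uniqueness of the Fourier transform in several variables is derived from Levy's theorem on the real
  line by treating one coordinate after the other (\<open>expectation_cylinder_eq_0_of_fourier\<close>).
\<close>

section \<open>Functionals and density in Hilbert spaces\<close>

text \<open>
  The Riesz argument by minimization of \<open>norm (L \<phi>)\<^sup>2 - 2 p \<phi>\<close>. The functional only has to be
  controlled by \<open>norm (L \<phi>)\<close>, so that one argument serves three purposes: representing a continuous
  functional on a Hilbert space (\<open>L\<close> the identity), representing an element of the dual of the native
  space (\<open>L\<close> the whitening operator), and projecting on the closure of a subspace.
\<close>

lemma riesz_along_linear_map:
  fixes L :: "'s::real_vector \<Rightarrow> 'l::{real_inner,complete_space}" and p :: "'s \<Rightarrow> real"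
  assumes L: "linear L" and p: "linear p" and bound: "\<And>\<phi>. \<bar>p \<phi>\<bar> \<le> C * norm (L \<phi>)"
  shows "\<exists>v\<in>closure (range L). \<forall>\<phi>. inner v (L \<phi>) = p \<phi>"
proof -
  define J where "J \<phi> = (norm (L \<phi>))\<^sup>2 - 2 * p \<phi>" for \<phi>
  define m where "m = Inf (range J)"
  have expand: "J (\<phi> + t *\<^sub>R \<psi>) = J \<phi> + 2 * t * (inner (L \<phi>) (L \<psi>) - p \<psi>) + t\<^sup>2 * (norm (L \<psi>))\<^sup>2" for \<phi> \<psi> t
    unfolding J_def linear_add[OF L] linear_add[OF p] linear_scale[OF L] linear_scale[OF p] power2_norm_eq_inner
    by (simp add: inner_simps inner_commute power2_eq_square algebra_simps)
  \<comment> \<open>\<open>J \<phi> \<ge> x\<^sup>2 - 2 C x\<close> with \<open>x = norm (L \<phi>)\<close>; complete the square in \<open>x\<close>\<close>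
  have "- C\<^sup>2 \<le> J \<phi>" for \<phi>
  proof -
    have "0 \<le> (norm (L \<phi>) - C)\<^sup>2" by simp
    then show ?thesis using bound[of \<phi>] unfolding J_def by (simp add: power2_diff algebra_simps)
  qed
  then have "bdd_below (range J)" by (intro bdd_belowI) auto
  then have m: "m \<le> J \<phi>" for \<phi> unfolding m_def by (simp add: cINF_lower)
  have "\<exists>\<phi>. J \<phi> < m + inverse (real (Suc n))" for n
    using cInf_lessD[of "range J" "m + inverse (real (Suc n))"] unfolding m_def by auto
  then obtain u where u: "\<And>n. J (u n) < m + inverse (real (Suc n))" by metis
  \<comment> \<open>the parallelogram law at the midpoint of two approximate minimizers\<close>
  have par: "(norm (L (u i) - L (u k)))\<^sup>2 \<le> 2 * (inverse (real (Suc i)) + inverse (real (Suc k)))" for i k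
  proof -
    have "J ((1/2) *\<^sub>R u i + (1/2) *\<^sub>R u k) = (J (u i) + J (u k)) / 2 - (norm (L (u i) - L (u k)))\<^sup>2 / 4"
      unfolding J_def linear_add[OF L] linear_add[OF p] linear_scale[OF L] linear_scale[OF p] power2_norm_eq_inner
      by (simp add: inner_simps inner_commute field_simps)
    then show ?thesis using m[of "(1/2) *\<^sub>R u i + (1/2) *\<^sub>R u k"] u[of i] u[of k] by argo
  qed
  have "Cauchy (\<lambda>n. L (u n))"
  proof (rule CauchyI)
    fix e :: real assume e: "0 < e"
    then obtain N where N: "inverse (real (Suc N)) < e\<^sup>2 / 4" using reals_Archimedean[of "e\<^sup>2/4"] by auto
    have "norm (L (u i) - L (u k)) < e" if "i \<ge> N" "k \<ge> N" for i k
    proof -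
      have "inverse (real (Suc i)) \<le> inverse (real (Suc N))" "inverse (real (Suc k)) \<le> inverse (real (Suc N))"
        using that by (auto intro!: le_imp_inverse_le)
      then have "(norm (L (u i) - L (u k)))\<^sup>2 < e\<^sup>2" using par[of i k] N by argo
      then show ?thesis using e power2_less_imp_less less_imp_le by metis
    qed
    then show "\<exists>M. \<forall>m\<ge>M. \<forall>n\<ge>M. norm (L (u m) - L (u n)) < e" by blast
  qed
  then obtain v where v: "(\<lambda>n. L (u n)) \<longlonglongrightarrow> v" using Cauchy_convergent_iff convergent_def by blast
  have Ju: "(\<lambda>n. J (u n)) \<longlonglongrightarrow> m"
  proof (rule real_tendsto_sandwich[of "\<lambda>n. m" _ _ "\<lambda>n. m + inverse (real (Suc n))"])
    show "(\<lambda>n. m + inverse (real (Suc n))) \<longlonglongrightarrow> m"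
      using tendsto_add[OF tendsto_const[of m] LIMSEQ_inverse_real_of_nat] by simp
  qed (use m u less_imp_le in \<open>auto intro!: always_eventually\<close>)
  have "inner v (L \<psi>) = p \<psi>" for \<psi>
  proof -
    define d where "d = inner v (L \<psi>) - p \<psi>"
    have ge: "0 \<le> 2 * t * d + t\<^sup>2 * (norm (L \<psi>))\<^sup>2" for t
    proof -
      have "(\<lambda>n. J (u n + t *\<^sub>R \<psi>)) \<longlonglongrightarrow> m + 2 * t * d + t\<^sup>2 * (norm (L \<psi>))\<^sup>2"
        unfolding expand d_def by (intro tendsto_intros Ju v)
      from tendsto_lowerbound[OF this, of m] show ?thesis using m by auto
    qed
    \<comment> \<open>the summand \<open>1\<close> makes the best step \<open>t = - d / s\<close> meaningful when \<open>L \<psi> = 0\<close>\<close>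
    define s where "s = (norm (L \<psi>))\<^sup>2 + 1"
    have s: "s > 0" unfolding s_def by (simp add: add_nonneg_pos)
    have "0 \<le> 2 * (- d / s) * d + (- d / s)\<^sup>2 * s"
      using ge[of "- d / s"] mult_left_mono[of "(norm (L \<psi>))\<^sup>2" s "(- d / s)\<^sup>2"]
      unfolding s_def[symmetric] by (simp add: s_def)
    also have "\<dots> = - (d\<^sup>2 / s)" using s by (simp add: field_simps power2_eq_square)
    finally have "d\<^sup>2 \<le> 0" using s by (simp add: divide_le_0_iff)
    then show ?thesis unfolding d_def by simp
  qed
  moreover have "v \<in> closure (range L)" unfolding closure_sequential using v by (auto intro!: exI[of _ "\<lambda>n. L (u n)"])
  ultimately show ?thesis by blast
qed

lemma riesz_representation:
  fixes f :: "'l::{real_inner,complete_space} \<Rightarrow> real"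
  assumes "bounded_linear f"
  obtains v where "\<And>w. inner v w = f w"
proof -
  obtain K where K: "\<And>x. norm (f x) \<le> norm x * K"
    using bounded_linear.bounded[OF assms] by blast
  have "\<exists>v\<in>closure (range (\<lambda>x. x)). \<forall>w. inner v ((\<lambda>x. x) w) = f w"
    by (rule riesz_along_linear_map[where C = K])
      (use K in \<open>auto simp: mult.commute linear_iff bounded_linear.linear[OF assms]
        linear_add[OF bounded_linear.linear[OF assms]] linear_scale[OF bounded_linear.linear[OF assms]]\<close>)
  then show ?thesis using that by auto
qed

text \<open>
  Representing \<open>inner x\<close> along \<open>K\<close> yields the orthogonal projection of \<open>x\<close> on the closure of the range.
\<close>

lemma dense_range_of_trivial_orthogonal_complement:
  fixes K :: "'s::real_vector \<Rightarrow> 'l::{real_inner,complete_space}"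
  assumes K: "linear K" and orth: "\<And>w. (\<And>\<phi>. inner w (K \<phi>) = 0) \<Longrightarrow> w = 0"
  shows "closure (range K) = UNIV"
proof (intro equalityI subsetI)
  fix x :: 'l
  have "\<exists>v\<in>closure (range K). \<forall>\<phi>. inner v (K \<phi>) = inner x (K \<phi>)"
    by (rule riesz_along_linear_map[where C = "norm x"])
      (auto simp: K linear_iff linear_add[OF K] linear_scale[OF K] inner_simps Cauchy_Schwarz_ineq2)
  then obtain v where "v \<in> closure (range K)" and "\<And>\<phi>. inner (x - v) (K \<phi>) = 0"
    by (auto simp: inner_simps)
  with orth[of "x - v"] show "x \<in> closure (range K)" by simp
qed simp

text \<open>
  Extensions by continuity are limits along such filters; density of the range makes these limits unique.
\<close>

lemma filtercomap_nhds_neq_bot: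
  assumes "x \<in> closure (range K)"
  shows "filtercomap K (nhds x) \<noteq> bot"
proof (rule filtercomap_neq_bot)
  fix P assume "eventually P (nhds x)"
  then obtain S where "open S" "x \<in> S" "\<And>y. y \<in> S \<Longrightarrow> P y" by (auto simp: eventually_nhds)
  with assms show "\<exists>\<phi>. P (K \<phi>)" unfolding closure_iff_nhds_not_empty by blast
qed

text \<open>
  By homogeneity the supremum \<open>N\<close> satisfies \<open>\<bar>inner v w\<bar> \<le> N * norm w\<close> on the range of \<open>L\<close>, and by
  density everywhere; \<open>w = v\<close> gives the nontrivial inequality.
\<close>

lemma norm_eq_Sup_dense_range:
  fixes L :: "'s::real_vector \<Rightarrow> 'l::real_inner"
  assumes L: "linear L" and dense: "closure (range L) = UNIV"
  shows "Sup {\<bar>inner v (L \<phi>)\<bar> |\<phi>. norm (L \<phi>) \<le> 1} = norm v"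
proof -
  let ?S = "{\<bar>inner v (L \<phi>)\<bar> |\<phi>. norm (L \<phi>) \<le> 1}"
  have ne: "?S \<noteq> {}" using linear_0[OF L] by (auto intro!: exI[of _ 0])
  have ub: "x \<le> norm v" if "x \<in> ?S" for x
  proof -
    from that obtain \<phi> where \<phi>: "x = \<bar>inner v (L \<phi>)\<bar>" "norm (L \<phi>) \<le> 1" by auto
    have "x \<le> norm v * norm (L \<phi>)" using \<phi> Cauchy_Schwarz_ineq2 by auto
    also have "\<dots> \<le> norm v * 1" using \<phi> by (intro mult_left_mono) auto
    finally show ?thesis by simp
  qed
  have bdd: "bdd_above ?S" using ub by (intro bdd_aboveI)
  have on_range: "\<bar>inner v (L \<phi>)\<bar> \<le> Sup ?S * norm (L \<phi>)" for \<phi>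
  proof (cases "L \<phi> = 0")
    case False
    have "\<bar>inner v (L (inverse (norm (L \<phi>)) *\<^sub>R \<phi>))\<bar> \<le> Sup ?S"
      using False by (intro cSup_upper bdd) (auto simp: linear_scale[OF L] intro!: exI[of _ "inverse (norm (L \<phi>)) *\<^sub>R \<phi>"])
    then show ?thesis using False by (simp add: linear_scale[OF L] abs_mult field_simps)
  qed simp
  have closed: "closed {w. \<bar>inner v w\<bar> \<le> Sup ?S * norm w}"
    by (intro closed_Collect_le continuous_intros)
  have "closure (range L) \<subseteq> {w. \<bar>inner v w\<bar> \<le> Sup ?S * norm w}"
    using on_range by (intro closure_minimal closed) auto
  then have "\<bar>inner v v\<bar> \<le> Sup ?S * norm v" using dense by blast
  then have "norm v \<le> Sup ?S"
  proof (cases "v = 0")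
    case True
    then have "?S = {0}" using ne by auto
    then show ?thesis using True by simp
  qed (simp add: power2_norm_eq_inner[symmetric] power2_eq_square)
  moreover have "Sup ?S \<le> norm v" using ne ub by (rule cSup_least)
  ultimately show ?thesis by simp
qed

lemma bounded_linear_of_continuous:
  fixes f :: "'a::real_normed_vector \<Rightarrow> real"
  assumes lin: "linear f" and cont: "continuous_on UNIV f"
  shows "bounded_linear f"
proof -
  have "isCont f 0" using cont by (simp add: continuous_on_eq_continuous_at)
  then have "\<exists>d>0. \<forall>x. dist x 0 < d \<longrightarrow> dist (f x) (f 0) < 1"
    unfolding continuous_at_eps_delta using zero_less_one by blast
  then obtain d where d: "d > 0" and near: "\<And>x. norm x < d \<Longrightarrow> \<bar>f x\<bar> < 1"
    by (auto simp: linear_0[OF lin])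
  have "norm (f x) \<le> norm x * (2 / d)" for x
  proof (cases "x = 0")
    case False
    have "\<bar>f ((d / (2 * norm x)) *\<^sub>R x)\<bar> < 1" using False d by (intro near) simp
    then show ?thesis using False d by (simp add: linear_scale[OF lin] abs_mult field_simps)
  qed (simp add: linear_0[OF lin])
  then show ?thesis
    by (intro bounded_linear_intro[of f "2 / d"]) (simp_all add: linear_add[OF lin] linear_scale[OF lin])
qed

lemma filtercomap_norm_diff_nhds_0:
  fixes v :: "'a::real_normed_vector"
  shows "filtercomap (\<lambda>\<phi>. norm (K \<phi> - v)) (nhds 0) = filtercomap K (nhds v)"
proof -
  have "filtercomap (\<lambda>x. norm (x - v)) (nhds 0) = nhds v"
  proof (rule filter_eqI)
    fix P :: "'a \<Rightarrow> bool"
    show "eventually P (filtercomap (\<lambda>x. norm (x - v)) (nhds 0)) \<longleftrightarrow> eventually P (nhds v)"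
    proof
      assume "eventually P (nhds v)"
      then obtain d where d: "d > 0" "\<And>x. dist x v < d \<Longrightarrow> P x" by (auto simp: eventually_nhds_metric)
      have "eventually (\<lambda>y. y < d) (nhds (0::real))"
        using d(1) by (intro eventually_nhds_in_open[of "{..<d}" 0, simplified]) auto
      then show "eventually P (filtercomap (\<lambda>x. norm (x - v)) (nhds 0))"
        unfolding eventually_filtercomap using d(2) by (auto simp: dist_norm intro!: exI[of _ "\<lambda>y. y < d"])
    next
      assume "eventually P (filtercomap (\<lambda>x. norm (x - v)) (nhds 0))"
      then obtain Q where Q: "eventually Q (nhds (0::real))" "\<And>x. Q (norm (x - v)) \<Longrightarrow> P x"
        by (auto simp: eventually_filtercomap)
      have "((\<lambda>x. norm (x - v)) \<longlongrightarrow> norm (v - v)) (nhds v)"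
        by (intro tendsto_intros filterlim_ident)
      with Q(1) have "eventually (\<lambda>x. Q (norm (x - v))) (nhds v)" by (simp add: filterlim_iff)
      then show "eventually P (nhds v)" using Q(2) by (rule eventually_mono)
    qed
  qed
  then show ?thesis using filtercomap_filtercomap[of K "\<lambda>x. norm (x - v)" "nhds 0"] by simp
qed

section \<open>The native space seen in the pivot space\<close>

text \<open>
  The setting of the theorem without the process. The aim is to express the native space, its dual and
  the operator \<open>A\<close> through the Hilbert space \<open>'l\<close>, where they become inner products and norms.
\<close>

locale native_setting =
  fixes pr :: "'d::{real_vector,topological_ab_group_add,t2_space}
                 \<Rightarrow> 's::{real_vector,topological_ab_group_add,t2_space} \<Rightarrow> real"
    and emb :: "'s \<Rightarrow> 'd"
    and j L :: "'s \<Rightarrow> 'l::{real_inner,complete_space}"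
    and Linv :: "'l \<Rightarrow> 'd"
  assumes dual_pair: "nuclear_dual_pair pr emb"
    and pivot: "pivot_space pr emb j"
    and whitening: "invertible_operator pr emb j L Linv"
begin

lemma linear_L: "linear L" and linear_Linv: "linear Linv" and Linv_L: "Linv (L \<phi>) = emb \<phi>"
  and continuous_Linv: "continuous_on UNIV Linv"
  and single_valued_ext: "single_valued (ext_graph emb L)"
  using whitening unfolding invertible_operator_def by auto

lemma emb_symmetric: "pr (emb \<phi>) \<psi> = pr (emb \<psi>) \<phi>"
  using dual_pair unfolding nuclear_dual_pair_def by auto

lemma linear_pr: "linear (pr u)" and linear_pr_left: "linear (\<lambda>u. pr u \<phi>)"
  using dual_pair unfolding nuclear_dual_pair_def strong_dual_def bilinear_def by auto

lemma continuous_pr_left: "continuous_on UNIV (\<lambda>u. pr u \<phi>)"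
proof -
  have "bij_betw (\<lambda>\<phi> u. pr u \<phi>) UNIV {l. linear l \<and> continuous_on UNIV l}"
    using dual_pair unfolding nuclear_dual_pair_def strong_dual_def by auto
  then show ?thesis by (auto simp: bij_betw_def)
qed

lemma pr_ext: "(\<And>\<phi>. pr u \<phi> = pr v \<phi>) \<Longrightarrow> u = v"
proof -
  assume "\<And>\<phi>. pr u \<phi> = pr v \<phi>"
  moreover have "inj pr"
    using dual_pair unfolding nuclear_dual_pair_def strong_dual_def bij_betw_def by auto
  ultimately show ?thesis by (metis injD ext)
qed

lemma ext_op_eq: "(f, w) \<in> ext_graph emb L \<Longrightarrow> ext_op emb L f = w"
  unfolding ext_op_def using single_valued_ext by (auto simp: single_valued_def)

text \<open>
  The identity \<open>L L\<^sup>-\<^sup>1 \<phi> = \<phi>\<close>, for the extension of \<open>L\<close>, puts the dense subspace \<open>range j\<close> inside the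
  closure of the range of \<open>L\<close>.
\<close>

lemma dense_range_L: "closure (range L) = UNIV"
proof -
  have "j \<phi> \<in> closure (range L)" for \<phi>
  proof -
    have "Linv (j \<phi>) \<in> Domain (ext_graph emb L)" and e: "ext_op emb L (Linv (j \<phi>)) = j \<phi>"
      using whitening unfolding invertible_operator_def native_space_def by auto
    then have "(Linv (j \<phi>), j \<phi>) \<in> closure (range (\<lambda>\<phi>. (emb \<phi>, L \<phi>)))"
      using ext_op_eq unfolding ext_graph_def by auto
    also have "\<dots> \<subseteq> closure (UNIV \<times> range L)" by (intro closure_mono) auto
    finally show ?thesis by (simp add: closure_Times)
  qed
  then have "closure (range j) \<subseteq> closure (range L)" by (intro closure_minimal) auto
  then show ?thesis using pivot unfolding pivot_space_def by auto
qed

text \<open>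
  The graph of \<open>L\<^sup>-\<^sup>1\<close>, read backwards, is closed and contains the graph of \<open>L\<close>. Conversely it is the
  continuous image of \<open>closure (range L)\<close>, which is everything. Hence \<open>L\<close> extends to the inverse of \<open>L\<^sup>-\<^sup>1\<close>,
  and the single-valuedness of the extension becomes the injectivity of \<open>L\<^sup>-\<^sup>1\<close>.
\<close>

lemma ext_graph_eq: "ext_graph emb L = range (\<lambda>w. (Linv w, w))"
proof
  have "closed {p. fst p = Linv (snd p)}"
    by (intro closed_Collect_eq continuous_intros continuous_on_compose2[OF continuous_Linv]) auto
  then have "ext_graph emb L \<subseteq> {p. fst p = Linv (snd p)}"
    unfolding ext_graph_def by (intro closure_minimal) (auto simp: Linv_L)
  then show "ext_graph emb L \<subseteq> range (\<lambda>w. (Linv w, w))" by auto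
  have "(\<lambda>w. (Linv w, w)) ` closure (range L) \<subseteq> ext_graph emb L"
    unfolding ext_graph_def using closure_subset
    by (intro image_closure_subset continuous_intros continuous_on_subset[OF continuous_Linv])
      (auto simp: Linv_L intro!: subsetD[OF closure_subset])
  then show "range (\<lambda>w. (Linv w, w)) \<subseteq> ext_graph emb L" by (simp add: dense_range_L)
qed

lemma ext_op_Linv: "ext_op emb L (Linv w) = w"
  by (rule ext_op_eq) (simp add: ext_graph_eq)

lemma native_space_eq: "native_space emb L = range Linv"
  unfolding native_space_def ext_graph_eq by auto

lemma Linv_eq_0: "Linv w = 0 \<Longrightarrow> w = 0"
  using ext_op_Linv[of w] ext_op_Linv[of 0] linear_0[OF linear_Linv] by simp

lemma inner_inv_adjoint: "inner (inv_adjoint pr Linv \<phi>) w = pr (Linv w) \<phi>"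
proof -
  have "bounded_linear (\<lambda>w. pr (Linv w) \<phi>)"
    using linear_compose[OF linear_Linv linear_pr_left[of \<phi>]]
      continuous_on_compose2[OF continuous_pr_left continuous_Linv]
    by (intro bounded_linear_of_continuous) (auto simp: o_def)
  then obtain v where v: "\<And>w. inner v w = pr (Linv w) \<phi>" using riesz_representation by blast
  have "\<forall>w. inner (inv_adjoint pr Linv \<phi>) w = pr (Linv w) \<phi>"
    unfolding inv_adjoint_def
  proof (rule theI[of _ v])
    show "u = v" if "\<forall>w. inner u w = pr (Linv w) \<phi>" for u
      using that v by (subst vector_eq_rdot[symmetric]) simp
  qed (simp add: v)
  then show ?thesis by blast
qed

lemma linear_inv_adjoint: "linear (inv_adjoint pr Linv)"
proof (rule linearI)
  show "inv_adjoint pr Linv (\<phi> + \<psi>) = inv_adjoint pr Linv \<phi> + inv_adjoint pr Linv \<psi>" for \<phi> \<psi>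
    by (subst vector_eq_rdot[symmetric])
      (simp add: inner_add_left inner_inv_adjoint linear_add[OF linear_pr])
  show "inv_adjoint pr Linv (c *\<^sub>R \<phi>) = c *\<^sub>R inv_adjoint pr Linv \<phi>" for c \<phi>
    by (subst vector_eq_rdot[symmetric]) (simp add: inner_inv_adjoint linear_scale[OF linear_pr])
qed

text \<open>
  A vector orthogonal to the range of the adjoint is annihilated by \<open>L\<^sup>-\<^sup>1\<close>. Since \<open>L\<^sup>-\<^sup>1\<^sup>* \<phi>\<close> turns out to
  represent \<open>emb \<phi>\<close>, this is the density of \<open>\<S>\<close> in \<open>\<H>'\<close>.
\<close>

lemma dense_range_inv_adjoint: "closure (range (inv_adjoint pr Linv)) = UNIV"
proof (rule dense_range_of_trivial_orthogonal_complement[OF linear_inv_adjoint])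
  fix w assume "\<And>\<phi>. inner w (inv_adjoint pr Linv \<phi>) = 0"
  then have "pr (Linv w) \<phi> = pr 0 \<phi>" for \<phi>
    using inner_inv_adjoint[of \<phi> w] linear_0[OF linear_pr_left] by (simp add: inner_commute)
  then show "w = 0" by (intro Linv_eq_0 pr_ext)
qed

lemma gram_op_eq: "pr (gram_op pr Linv \<phi>) \<psi> = inner (inv_adjoint pr Linv \<phi>) (inv_adjoint pr Linv \<psi>)"
  unfolding gram_op_def inner_inv_adjoint[symmetric] by (rule inner_commute)

text \<open>
  On \<open>\<H>'\<close> this is the isometric extension of the adjoint \<open>L\<^sup>-\<^sup>1\<^sup>*\<close> from \<open>\<S>\<close>.
\<close>

definition representer :: "'d \<Rightarrow> 'l" where
  "representer \<nu> = (THE v. \<forall>\<phi>. inner v (L \<phi>) = pr \<nu> \<phi>)"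

lemma eq_of_inner_L:
  assumes "\<And>\<phi>. inner v (L \<phi>) = inner w (L \<phi>)"
  shows "v = w"
proof -
  have "closure (range L) \<subseteq> {x. inner v x = inner w x}"
    using assms by (intro closure_minimal closed_Collect_eq continuous_intros) auto
  then show ?thesis using dense_range_L by (subst vector_eq_rdot[symmetric]) blast
qed

lemma representer_eqI: "(\<And>\<phi>. inner v (L \<phi>) = pr \<nu> \<phi>) \<Longrightarrow> representer \<nu> = v"
  unfolding representer_def by (intro the_equality) (auto intro: eq_of_inner_L)

lemma inner_representer:
  assumes "\<nu> \<in> native_dual pr L"
  shows "inner (representer \<nu>) (L \<phi>) = pr \<nu> \<phi>"
proof -
  from assms obtain C where "\<And>\<phi>. \<bar>pr \<nu> \<phi>\<bar> \<le> C * norm (L \<phi>)" unfolding native_dual_def by auto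
  from riesz_along_linear_map[OF linear_L linear_pr this]
  obtain v where v: "\<And>\<phi>. inner v (L \<phi>) = pr \<nu> \<phi>" by blast
  with representer_eqI[OF v] show ?thesis by simp
qed

lemma in_native_dualI: "(\<And>\<phi>. inner v (L \<phi>) = pr \<nu> \<phi>) \<Longrightarrow> \<nu> \<in> native_dual pr L"
proof -
  assume "\<And>\<phi>. inner v (L \<phi>) = pr \<nu> \<phi>"
  then have "\<bar>pr \<nu> \<phi>\<bar> \<le> norm v * norm (L \<phi>)" for \<phi> using Cauchy_Schwarz_ineq2[of v "L \<phi>"] by simp
  then show ?thesis unfolding native_dual_def by blast
qed

lemma inner_inv_adjoint_L: "inner (inv_adjoint pr Linv \<phi>) (L \<psi>) = pr (emb \<phi>) \<psi>"
  using emb_symmetric[of \<phi> \<psi>] by (simp add: inner_inv_adjoint Linv_L)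

lemma emb_in_native_dual: "emb \<phi> \<in> native_dual pr L"
  by (rule in_native_dualI) (rule inner_inv_adjoint_L)

lemma native_dual_norm_eq:
  assumes "\<And>\<phi>. inner v (L \<phi>) = pr \<nu> \<phi>"
  shows "native_dual_norm pr L \<nu> = norm v"
  unfolding native_dual_norm_def assms[symmetric] by (rule norm_eq_Sup_dense_range[OF linear_L dense_range_L])

text \<open>
  Convergence in \<open>\<H>'\<close> is convergence of the representers, because the dual norm of \<open>emb \<phi> - \<nu>\<close> is the
  distance of \<open>L\<^sup>-\<^sup>1\<^sup>* \<phi>\<close> to the representer of \<open>\<nu>\<close>.
\<close>

lemma to_dual_eq:
  assumes "\<nu> \<in> native_dual pr L"
  shows "to_dual pr emb L \<nu> = filtercomap (inv_adjoint pr Linv) (nhds (representer \<nu>))"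
proof -
  have "native_dual_norm pr L (emb \<phi> - \<nu>) = norm (inv_adjoint pr Linv \<phi> - representer \<nu>)" for \<phi>
    by (rule native_dual_norm_eq)
      (simp add: inner_diff_left inner_inv_adjoint_L inner_representer[OF assms] linear_diff[OF linear_pr_left])
  then show ?thesis unfolding to_dual_def by (simp add: filtercomap_norm_diff_nhds_0)
qed

text \<open>
  As \<open>A = L\<^sup>-\<^sup>1 L\<^sup>-\<^sup>1\<^sup>*\<close> with \<open>L\<^sup>-\<^sup>1\<close> continuous, passing to the limit replaces \<open>L\<^sup>-\<^sup>1\<^sup>* \<phi>\<close> by the representer.
\<close>

lemma ext_gram_eq:
  assumes "\<nu> \<in> native_dual pr L"
  shows "ext_gram pr emb L (gram_op pr Linv) \<nu> = Linv (representer \<nu>)"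
  unfolding ext_gram_def to_dual_eq[OF assms]
proof (rule tendsto_Lim)
  show "filtercomap (inv_adjoint pr Linv) (nhds (representer \<nu>)) \<noteq> bot"
    by (rule filtercomap_nhds_neq_bot) (simp add: dense_range_inv_adjoint)
  have "(Linv \<longlongrightarrow> Linv (representer \<nu>)) (nhds (representer \<nu>))"
    using continuous_Linv by (simp add: continuous_on_eq_continuous_at isCont_def tendsto_at_iff_tendsto_nhds)
  then show "(gram_op pr Linv \<longlongrightarrow> Linv (representer \<nu>))
     (filtercomap (inv_adjoint pr Linv) (nhds (representer \<nu>)))"
    unfolding gram_op_def[abs_def] by (rule filterlim_filtercomapI)
qed

lemma native_pairing_eq:
  assumes "\<nu> \<in> native_dual pr L"
  shows "native_pairing pr emb L \<nu> (Linv w) = inner (representer \<nu>) w"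
  unfolding native_pairing_def ext_op_Linv
proof (rule tendsto_Lim)
  show "filtercomap L (nhds w) \<noteq> bot"
    by (rule filtercomap_nhds_neq_bot) (simp add: dense_range_L)
  have "((\<lambda>\<phi>. inner (representer \<nu>) (L \<phi>)) \<longlongrightarrow> inner (representer \<nu>) w) (filtercomap L (nhds w))"
    by (intro tendsto_intros filterlim_filtercomap)
  then show "(pr \<nu> \<longlongrightarrow> inner (representer \<nu>) w) (filtercomap L (nhds w))"
    by (simp add: inner_representer[OF assms])
qed

end

section \<open>Ridge regression and smoothing splines\<close>

lemma matrix_inv_right: "invertible A \<Longrightarrow> A ** matrix_inv A = mat 1"
  unfolding invertible_def matrix_inv_def by (rule someI2_ex) blast+

definition inner_gram :: "('m::finite \<Rightarrow> 'l::real_inner) \<Rightarrow> real ^ 'm ^ 'm" where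
  "inner_gram r = (\<chi> m n. inner (r m) (r n))"

definition ridge_cost :: "('m::finite \<Rightarrow> 'l::real_inner) \<Rightarrow> real \<Rightarrow> real ^ 'm \<Rightarrow> 'l \<Rightarrow> real" where
  "ridge_cost r lam y w = (norm (y - (\<chi> m. inner (r m) w)))\<^sup>2 + lam * (norm w)\<^sup>2"

definition ridge_coeffs :: "('m::finite \<Rightarrow> 'l::real_inner) \<Rightarrow> real \<Rightarrow> real ^ 'm \<Rightarrow> real ^ 'm" where
  "ridge_coeffs r lam y = matrix_inv (inner_gram r + lam *\<^sub>R mat 1) *v y"

lemma inner_gram_mult_nth: "(inner_gram r *v a) $ m = inner (r m) (\<Sum>n\<in>UNIV. a $ n *\<^sub>R r n)"
  unfolding inner_gram_def matrix_vector_mult_def by (simp add: inner_sum_right mult.commute)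

lemma regularized_gram_mult: "(inner_gram r + lam *\<^sub>R mat 1) *v a = inner_gram r *v a + lam *\<^sub>R a"
  by (simp add: matrix_vector_mult_add_rdistrib scaleR_matrix_vector_assoc[symmetric])

text \<open>
  The quadratic form of the matrix at \<open>a\<close> is \<open>norm (\<Sum>n. a $ n *\<^sub>R r n)\<^sup>2 + lam * norm a\<^sup>2\<close>.
\<close>

lemma invertible_regularized_gram:
  assumes "lam > 0"
  shows "invertible (inner_gram r + lam *\<^sub>R mat 1)"
proof -
  have "a = 0" if "(inner_gram r + lam *\<^sub>R mat 1) *v a = 0" for a
  proof -
    have "0 = inner a (inner_gram r *v a + lam *\<^sub>R a)"
      using that by (simp add: regularized_gram_mult)
    also have "\<dots> = (norm (\<Sum>n\<in>UNIV. a $ n *\<^sub>R r n))\<^sup>2 + lam * (norm a)\<^sup>2"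
      unfolding inner_add_right inner_scaleR_right power2_norm_eq_inner[symmetric]
      by (simp add: inner_vec_def[of a "inner_gram r *v a"] inner_gram_mult_nth power2_norm_eq_inner[of "sum _ _"]
          inner_sum_left)
    finally have "lam * (norm a)\<^sup>2 \<le> 0"
      using zero_le_power2[of "norm (\<Sum>n\<in>UNIV. a $ n *\<^sub>R r n)"] by linarith
    then show ?thesis using assms by (simp add: mult_le_0_iff)
  qed
  then obtain B where "B ** (inner_gram r + lam *\<^sub>R mat 1) = mat 1"
    using matrix_left_invertible_ker[of "inner_gram r + lam *\<^sub>R mat 1"] by blast
  then show ?thesis unfolding invertible_def using matrix_left_right_inverse by blast
qed

lemma ridge_coeffs_eq:
  assumes "lam > 0"
  shows "inner_gram r *v ridge_coeffs r lam y + lam *\<^sub>R ridge_coeffs r lam y = y"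
proof -
  have "inner_gram r *v ridge_coeffs r lam y + lam *\<^sub>R ridge_coeffs r lam y =
      (inner_gram r + lam *\<^sub>R mat 1) *v ridge_coeffs r lam y"
    by (rule regularized_gram_mult[symmetric])
  also have "\<dots> = y"
    unfolding ridge_coeffs_def matrix_vector_mul_assoc matrix_inv_right[OF invertible_regularized_gram[OF assms]]
    by simp
  finally show ?thesis .
qed

text \<open>
  The cost is a quadratic polynomial in \<open>w\<close> whose linear part vanishes at \<open>w0\<close>: there the residual
  \<open>y - (inner (r m) w0)\<^sub>m\<close> equals \<open>lam *\<^sub>R a\<close> by the equations for the coefficients \<open>a\<close>, and the adjoint of
  \<open>w \<mapsto> (inner (r m) w)\<^sub>m\<close> maps it to \<open>lam *\<^sub>R w0\<close>.
\<close>

lemma ridge_cost_expand: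
  fixes r :: "'m::finite \<Rightarrow> 'l::real_inner" and y :: "real ^ 'm"
  assumes lam: "lam > 0"
  defines "w0 \<equiv> \<Sum>n\<in>UNIV. ridge_coeffs r lam y $ n *\<^sub>R r n"
  shows "ridge_cost r lam y w =
    ridge_cost r lam y w0 + (norm (\<chi> m. inner (r m) (w - w0)))\<^sup>2 + lam * (norm (w - w0))\<^sup>2"
proof -
  define a where "a = ridge_coeffs r lam y"
  define R where "R u = (\<chi> m. inner (r m) u)" for u
  define h where "h = w - w0"
  have "R w0 = inner_gram r *v a"
    by (simp add: vec_eq_iff R_def w0_def a_def inner_gram_mult_nth)
  then have res: "y - R w0 = lam *\<^sub>R a" using ridge_coeffs_eq[OF lam, of r y] unfolding a_def by (metis add_diff_cancel_left')
  have adj: "inner a (R h) = inner w0 h"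
    by (simp add: inner_vec_def R_def w0_def a_def inner_sum_left)
  have "y - R w = lam *\<^sub>R a - R h"
    unfolding res[symmetric] by (simp add: h_def R_def vec_eq_iff inner_diff_right)
  then have "(norm (y - R w))\<^sup>2 = (norm (y - R w0))\<^sup>2 - 2 * lam * inner w0 h + (norm (R h))\<^sup>2"
    unfolding res power2_norm_eq_inner using adj by (simp add: inner_simps inner_commute)
  moreover have "(norm w)\<^sup>2 = (norm w0)\<^sup>2 + 2 * inner w0 h + (norm h)\<^sup>2"
    unfolding power2_norm_eq_inner h_def by (simp add: inner_simps inner_commute)
  ultimately show ?thesis
    unfolding ridge_cost_def R_def[symmetric] h_def[symmetric] by (simp add: algebra_simps)
qed

lemma inner_inner_gram: "inner x (inner_gram r *v z) = inner (\<Sum>m\<in>UNIV. x $ m *\<^sub>R r m) (\<Sum>m\<in>UNIV. z $ m *\<^sub>R r m)"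
  by (simp add: inner_vec_def inner_gram_mult_nth inner_sum_left)

text \<open>
  Symmetry of \<open>(inner_gram r + lam *\<^sub>R mat 1)\<^sup>-\<^sup>1\<close>, which exchanges the roles of the data \<open>y\<close> and of the
  covariances \<open>b\<close> between the target and the measurements.
\<close>

lemma inner_ridge_coeffs:
  assumes "lam > 0"
  shows "inner b (ridge_coeffs r lam y) = inner (ridge_coeffs r lam b) y"
proof -
  have "inner (inner_gram r *v ridge_coeffs r lam b + lam *\<^sub>R ridge_coeffs r lam b) (ridge_coeffs r lam y) =
      inner (ridge_coeffs r lam b) (inner_gram r *v ridge_coeffs r lam y + lam *\<^sub>R ridge_coeffs r lam y)"
    by (simp add: inner_add_left inner_add_right inner_inner_gram inner_commute[of "inner_gram r *v _"] inner_commute)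
  then show ?thesis unfolding ridge_coeffs_eq[OF assms] .
qed

context native_setting
begin

lemma gram_matrix_eq:
  assumes "\<And>m. \<nu> m \<in> native_dual pr L"
  shows "gram_matrix pr emb L (gram_op pr Linv) \<nu> = inner_gram (\<lambda>m. representer (\<nu> m))"
  unfolding gram_matrix_def inner_gram_def native_dual_inner_def
  by (simp add: ext_gram_eq native_pairing_eq assms inner_commute)

lemma spline_cost_Linv:
  assumes "\<And>m. \<nu> m \<in> native_dual pr L"
  shows "spline_cost pr emb L \<nu> lam y (Linv w) = ridge_cost (\<lambda>m. representer (\<nu> m)) lam y w"
  unfolding spline_cost_def ridge_cost_def measure_vec_def ext_op_Linv by (simp add: native_pairing_eq assms)

text \<open>
  Through the bijection \<open>L\<^sup>-\<^sup>1\<close> onto the native space the spline problem is the ridge problem, where the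
  term \<open>lam * norm (w - w0)\<^sup>2\<close> of the expanded cost forces uniqueness.
\<close>

lemma spline_cost_minimizers:
  fixes \<nu> :: "'m::finite \<Rightarrow> 'd" and y :: "real ^ 'm"
  assumes \<nu>: "\<And>m. \<nu> m \<in> native_dual pr L" and lam: "lam > 0"
  defines "r \<equiv> \<lambda>m. representer (\<nu> m)"
  defines "w0 \<equiv> \<Sum>m\<in>UNIV. ridge_coeffs r lam y $ m *\<^sub>R r m"
  shows "is_arg_min (spline_cost pr emb L \<nu> lam y) (\<lambda>g. g \<in> native_space emb L) g \<longleftrightarrow> g = Linv w0"
proof -
  have cost: "spline_cost pr emb L \<nu> lam y (Linv w) =
      spline_cost pr emb L \<nu> lam y (Linv w0) + (norm (\<chi> m. inner (r m) (w - w0)))\<^sup>2 + lam * (norm (w - w0))\<^sup>2" for w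
    unfolding spline_cost_Linv[OF \<nu>] r_def[symmetric] w0_def by (rule ridge_cost_expand[OF lam])
  have ge: "spline_cost pr emb L \<nu> lam y (Linv w0) \<le> spline_cost pr emb L \<nu> lam y (Linv w)" for w
    using cost[of w] lam by simp
  have eq: "w = w0" if "spline_cost pr emb L \<nu> lam y (Linv w) \<le> spline_cost pr emb L \<nu> lam y (Linv w0)" for w
  proof -
    have "lam * (norm (w - w0))\<^sup>2 \<le> 0"
      using cost[of w] that zero_le_power2[of "norm (\<chi> m. inner (r m) (w - w0))"] by linarith
    then show ?thesis using lam by (simp add: mult_le_0_iff)
  qed
  show ?thesis
    unfolding is_arg_min_linorder native_space_eq
  proof
    assume *: "g \<in> range Linv \<and> (\<forall>h. h \<in> range Linv \<longrightarrow>
      spline_cost pr emb L \<nu> lam y g \<le> spline_cost pr emb L \<nu> lam y h)"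
    then obtain w where w: "g = Linv w" by auto
    with * have "spline_cost pr emb L \<nu> lam y (Linv w) \<le> spline_cost pr emb L \<nu> lam y (Linv w0)" by simp
    from eq[OF this] w show "g = Linv w0" by simp
  qed (use ge in auto)
qed

lemma smoothing_spline_eq:
  fixes \<nu> :: "'m::finite \<Rightarrow> 'd" and y :: "real ^ 'm"
  assumes \<nu>: "\<And>m. \<nu> m \<in> native_dual pr L" and lam: "lam > 0"
  defines "r \<equiv> \<lambda>m. representer (\<nu> m)"
  shows "smoothing_spline pr emb L \<nu> lam y = Linv (\<Sum>m\<in>UNIV. ridge_coeffs r lam y $ m *\<^sub>R r m)"
  unfolding smoothing_spline_def arg_min_def r_def
  by (rule some_equality) (simp_all add: spline_cost_minimizers[OF \<nu> lam])

end

section \<open>Uniqueness of the Fourier transform\<close>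

context prob_space
begin

lemma integrable_bounded_mult:
  fixes W f :: "'a \<Rightarrow> real"
  assumes "W \<in> borel_measurable M" "f \<in> borel_measurable M"
    and "\<And>\<omega>. \<bar>W \<omega>\<bar> \<le> 1" "\<And>\<omega>. \<bar>f \<omega>\<bar> \<le> 1"
  shows "integrable M (\<lambda>\<omega>. W \<omega> * f \<omega>)"
proof (rule integrable_const_bound[of _ 1])
  show "AE \<omega> in M. norm (W \<omega> * f \<omega>) \<le> 1"
    using assms(3,4) by (auto simp: abs_mult intro!: mult_le_one)
qed (use assms in measurable)

text \<open>
  Multiplying the probability by \<open>1 + W\<close> for a bounded centred \<open>W\<close> gives another probability. This turns
  statements on the signed measure \<open>B \<mapsto> E[W; Y \<in> B]\<close> into comparisons of two probability laws of \<open>Y\<close>.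
\<close>

lemma tilted_measure:
  fixes W :: "'a \<Rightarrow> real" and Y :: "'a \<Rightarrow> 'b::topological_space"
  assumes [measurable]: "W \<in> borel_measurable M" "Y \<in> borel_measurable M"
    and bound: "\<And>\<omega>. \<bar>W \<omega>\<bar> \<le> 1" and mean: "expectation W = 0"
  defines "Q \<equiv> distr (density M (\<lambda>\<omega>. ennreal (1 + W \<omega>))) borel Y"
  shows "prob_space Q" and "sets Q = sets borel"
    and "\<And>B. B \<in> sets borel \<Longrightarrow>
      measure Q B = measure (distr M borel Y) B + expectation (\<lambda>\<omega>. W \<omega> * indicator B (Y \<omega>))"
    and "\<And>f :: 'b \<Rightarrow> complex. f \<in> borel_measurable borel \<Longrightarrow> (\<And>y. norm (f y) \<le> 1) \<Longrightarrow>
      integral\<^sup>L Q f = (\<integral>\<omega>. f (Y \<omega>) \<partial>M) + (\<integral>\<omega>. W \<omega> *\<^sub>R f (Y \<omega>) \<partial>M)"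
proof -
  have intW: "integrable M W" by (rule integrable_const_bound[of _ 1]) (use bound in auto)
  have nonneg: "0 \<le> 1 + W \<omega>" for \<omega> using bound[of \<omega>] by linarith
  show sets: "sets Q = sets borel" unfolding Q_def by simp
  show em: "measure Q B = measure (distr M borel Y) B + expectation (\<lambda>\<omega>. W \<omega> * indicator B (Y \<omega>))"
    if [measurable]: "B \<in> sets borel" for B
  proof -
    have i1: "integrable M (\<lambda>\<omega>. indicat_real B (Y \<omega>))"
      by (rule integrable_const_bound[of _ 1]) auto
    have i2: "integrable M (\<lambda>\<omega>. W \<omega> * indicat_real B (Y \<omega>))"
      by (rule integrable_bounded_mult) (use bound in auto)
    have pos: "0 \<le> (1 + W \<omega>) * indicat_real B (Y \<omega>)" for \<omega> using nonneg by (simp add: indicator_def)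
    have "emeasure Q B = (\<integral>\<^sup>+\<omega>. ennreal ((1 + W \<omega>) * indicator B (Y \<omega>)) \<partial>M)"
      unfolding Q_def
      by (subst emeasure_distr, simp, simp, subst emeasure_density)
        (auto intro!: nn_integral_cong split: split_indicator)
    also have "\<dots> = ennreal (expectation (\<lambda>\<omega>. (1 + W \<omega>) * indicator B (Y \<omega>)))"
      using i1 i2 pos by (intro nn_integral_eq_integral AE_I2) (simp_all add: distrib_right)
    finally have "measure Q B = expectation (\<lambda>\<omega>. (1 + W \<omega>) * indicator B (Y \<omega>))"
      unfolding measure_def using pos by (simp add: integral_nonneg)
    also have "expectation (\<lambda>\<omega>. (1 + W \<omega>) * indicator B (Y \<omega>)) =
        expectation (\<lambda>\<omega>. indicat_real B (Y \<omega>)) + expectation (\<lambda>\<omega>. W \<omega> * indicator B (Y \<omega>))"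
      using i1 i2 by (simp add: distrib_right)
    also have "expectation (\<lambda>\<omega>. indicat_real B (Y \<omega>)) = measure (distr M borel Y) B"
      using integral_distr[of Y M borel "indicat_real B"] by simp
    finally show ?thesis .
  qed
  have "measure Q UNIV = 1"
    using em[of UNIV] mean prob_space.prob_space[OF prob_space_distr[of Y borel]] by simp
  then have "emeasure Q UNIV = 1"
    by (cases "emeasure Q UNIV" rule: ennreal_cases) (auto simp: measure_def)
  then show "prob_space Q" by (intro prob_spaceI) (simp add: Q_def)
  show "integral\<^sup>L Q f = (\<integral>\<omega>. f (Y \<omega>) \<partial>M) + (\<integral>\<omega>. W \<omega> *\<^sub>R f (Y \<omega>) \<partial>M)"
    if [measurable]: "f \<in> borel_measurable borel" and f: "\<And>y. norm (f y) \<le> 1" for f :: "'b \<Rightarrow> complex"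
  proof -
    have "integrable M (\<lambda>\<omega>. f (Y \<omega>))" by (rule integrable_const_bound[of _ 1]) (use f in auto)
    moreover have "integrable M (\<lambda>\<omega>. W \<omega> *\<^sub>R f (Y \<omega>))"
      by (rule integrable_const_bound[of _ 1]) (use f bound in \<open>auto intro!: mult_le_one\<close>)
    ultimately show ?thesis
      unfolding Q_def using nonneg by (simp add: integral_distr integral_density scaleR_add_left)
  qed
qed

text \<open>
  The hypotheses say that \<open>Y\<close> has the same characteristic function under the original and the tilted
  probability, so that Levy's uniqueness theorem applies.
\<close>

lemma expectation_indicator_eq_0_of_fourier:
  fixes W Y :: "'a \<Rightarrow> real"
  assumes [measurable]: "W \<in> borel_measurable M" "Y \<in> borel_measurable M" "B \<in> sets borel"
    and bound: "\<And>\<omega>. \<bar>W \<omega>\<bar> \<le> 1"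
    and cos: "\<And>t. expectation (\<lambda>\<omega>. W \<omega> * cos (t * Y \<omega>)) = 0"
    and sin: "\<And>t. expectation (\<lambda>\<omega>. W \<omega> * sin (t * Y \<omega>)) = 0"
  shows "expectation (\<lambda>\<omega>. W \<omega> * indicator B (Y \<omega>)) = 0"
proof -
  define Q where "Q = distr (density M (\<lambda>\<omega>. ennreal (1 + W \<omega>))) borel Y"
  have mean: "expectation W = 0" using cos[of 0] by simp
  note Q = tilted_measure[OF assms(1,2) bound mean, folded Q_def]
  have D: "real_distribution (distr M borel Y)" by (simp add: real_distribution_distr)
  have "char Q = char (distr M borel Y)"
  proof
    fix t
    have i: "integrable M (\<lambda>\<omega>. W \<omega> *\<^sub>R iexp (t * Y \<omega>))"
      by (rule integrable_const_bound[of _ 1]) (use bound in \<open>auto simp del: of_real_mult\<close>)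
    have "(\<integral>\<omega>. W \<omega> *\<^sub>R iexp (t * Y \<omega>) \<partial>M) = 0"
    proof (rule complex_eqI)
      show "Re (\<integral>\<omega>. W \<omega> *\<^sub>R iexp (t * Y \<omega>) \<partial>M) = Re 0"
        using cos[of t] by (subst integral_Re[OF i, symmetric]) (simp add: Re_exp)
      show "Im (\<integral>\<omega>. W \<omega> *\<^sub>R iexp (t * Y \<omega>) \<partial>M) = Im 0"
        using sin[of t] by (subst integral_Im[OF i, symmetric]) (simp add: Im_exp)
    qed
    then have "char Q t = (\<integral>\<omega>. iexp (t * Y \<omega>) \<partial>M)"
      unfolding char_def by (subst Q(4)) (auto simp del: of_real_mult)
    also have "\<dots> = char (distr M borel Y) t"
      unfolding char_def by (subst integral_distr) auto
    finally show "char Q t = char (distr M borel Y) t" .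
  qed
  then have "Q = distr M borel Y"
    using Q(1,2) D by (intro Levy_uniqueness) (auto simp: real_distribution_def real_distribution_axioms_def)
  then show ?thesis using Q(3)[of B] by simp
qed

text \<open>
  The several-variable version is obtained by replacing one trigonometric factor at a time with an
  indicator: the previous lemma applies to the coordinate \<open>k\<close> with \<open>W\<close> multiplied by the indicators of the
  other coordinates, and the induction hypothesis is used for \<open>W\<close> multiplied by \<open>cos (a * Y k)\<close> or
  \<open>sin (a * Y k)\<close>. All factors are bounded by \<open>1\<close>, which keeps the tilted measures available.
\<close>

lemma expectation_cylinder_eq_0_of_fourier:
  fixes W :: "'a \<Rightarrow> real" and Y :: "'i \<Rightarrow> 'a \<Rightarrow> real"
  assumes "finite I" and "\<And>i. i \<in> I \<Longrightarrow> Y i \<in> borel_measurable M" and "\<And>i. i \<in> I \<Longrightarrow> B i \<in> sets borel"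
    and "W \<in> borel_measurable M" and "\<And>\<omega>. \<bar>W \<omega>\<bar> \<le> 1"
    and "\<And>t. expectation (\<lambda>\<omega>. W \<omega> * cos (\<Sum>i\<in>I. t i * Y i \<omega>)) = 0"
    and "\<And>t. expectation (\<lambda>\<omega>. W \<omega> * sin (\<Sum>i\<in>I. t i * Y i \<omega>)) = 0"
  shows "expectation (\<lambda>\<omega>. W \<omega> * (\<Prod>i\<in>I. indicator (B i) (Y i \<omega>))) = 0"
  using assms
proof (induction I arbitrary: W rule: finite_induct)
  case empty
  then show ?case using empty.prems(5) by simp
next
  case (insert k I)
  have [measurable]: "W \<in> borel_measurable M" "Y k \<in> borel_measurable M" "B k \<in> sets borel"
    and YI[measurable]: "i \<in> I \<Longrightarrow> Y i \<in> borel_measurable M" and BI[measurable]: "i \<in> I \<Longrightarrow> B i \<in> sets borel" for i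
    using insert.prems by auto
  have bound: "\<bar>W \<omega>\<bar> \<le> 1" for \<omega> using insert.prems by auto
  define S where "S t \<omega> = (\<Sum>i\<in>I. t i * Y i \<omega>)" for t \<omega>
  have [measurable]: "S t \<in> borel_measurable M" for t
    unfolding S_def[abs_def] by measurable
  have split: "(\<Sum>i\<in>insert k I. (t(k := a)) i * Y i \<omega>) = a * Y k \<omega> + S t \<omega>" for t a \<omega>
  proof -
    have "(\<Sum>i\<in>I. (t(k := a)) i * Y i \<omega>) = S t \<omega>"
      unfolding S_def using insert.hyps by (intro sum.cong) auto
    then show ?thesis using insert.hyps by simp
  qed
  have c0: "expectation (\<lambda>\<omega>. W \<omega> * cos (a * Y k \<omega> + S t \<omega>)) = 0" for a t
    using insert.prems(5)[of "t(k := a)"] by (simp only: split)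
  have s0: "expectation (\<lambda>\<omega>. W \<omega> * sin (a * Y k \<omega> + S t \<omega>)) = 0" for a t
    using insert.prems(6)[of "t(k := a)"] by (simp only: split)
  have ic: "integrable M (\<lambda>\<omega>. W \<omega> * cos (a * Y k \<omega> + S t \<omega>))" for a t
    by (rule integrable_bounded_mult) (use bound in auto)
  have isin: "integrable M (\<lambda>\<omega>. W \<omega> * sin (a * Y k \<omega> + S t \<omega>))" for a t
    by (rule integrable_bounded_mult) (use bound in auto)
  \<comment> \<open>product-to-sum formulas: both signs of the frequency of the coordinate \<open>k\<close> are available\<close>
  have p2s: "cos x * cos y = (cos (x + y) + cos (- x + y)) / 2" "cos x * sin y = (sin (x + y) + sin (- x + y)) / 2"
    "sin x * cos y = (sin (x + y) - sin (- x + y)) / 2" "sin x * sin y = (cos (- x + y) - cos (x + y)) / 2" for x y :: real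
    by (simp_all add: cos_add sin_add cos_diff sin_diff)
  have cc: "expectation (\<lambda>\<omega>. W \<omega> * cos (a * Y k \<omega>) * cos (S t \<omega>)) = 0" for a t
  proof -
    have "(\<lambda>\<omega>. W \<omega> * cos (a * Y k \<omega>) * cos (S t \<omega>)) =
        (\<lambda>\<omega>. (W \<omega> * cos (a * Y k \<omega> + S t \<omega>) + W \<omega> * cos ((- a) * Y k \<omega> + S t \<omega>)) / 2)"
      unfolding mult.assoc p2s by (simp add: algebra_simps)
    then show ?thesis using c0[of a t] c0[of "- a" t] ic[of a t] ic[of "- a" t] by simp
  qed
  have cs: "expectation (\<lambda>\<omega>. W \<omega> * cos (a * Y k \<omega>) * sin (S t \<omega>)) = 0" for a t
  proof -
    have "(\<lambda>\<omega>. W \<omega> * cos (a * Y k \<omega>) * sin (S t \<omega>)) =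
        (\<lambda>\<omega>. (W \<omega> * sin (a * Y k \<omega> + S t \<omega>) + W \<omega> * sin ((- a) * Y k \<omega> + S t \<omega>)) / 2)"
      unfolding mult.assoc p2s by (simp add: algebra_simps)
    then show ?thesis using s0[of a t] s0[of "- a" t] isin[of a t] isin[of "- a" t] by simp
  qed
  have sc: "expectation (\<lambda>\<omega>. W \<omega> * sin (a * Y k \<omega>) * cos (S t \<omega>)) = 0" for a t
  proof -
    have "(\<lambda>\<omega>. W \<omega> * sin (a * Y k \<omega>) * cos (S t \<omega>)) =
        (\<lambda>\<omega>. (W \<omega> * sin (a * Y k \<omega> + S t \<omega>) - W \<omega> * sin ((- a) * Y k \<omega> + S t \<omega>)) / 2)"
      unfolding mult.assoc p2s by (simp add: algebra_simps)
    then show ?thesis using s0[of a t] s0[of "- a" t] isin[of a t] isin[of "- a" t] by simp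
  qed
  have ss: "expectation (\<lambda>\<omega>. W \<omega> * sin (a * Y k \<omega>) * sin (S t \<omega>)) = 0" for a t
  proof -
    have "(\<lambda>\<omega>. W \<omega> * sin (a * Y k \<omega>) * sin (S t \<omega>)) =
        (\<lambda>\<omega>. (W \<omega> * cos ((- a) * Y k \<omega> + S t \<omega>) - W \<omega> * cos (a * Y k \<omega> + S t \<omega>)) / 2)"
      unfolding mult.assoc p2s by (simp add: algebra_simps)
    then show ?thesis using c0[of a t] c0[of "- a" t] ic[of a t] ic[of "- a" t] by simp
  qed
  define P where "P \<omega> = (\<Prod>i\<in>I. indicat_real (B i) (Y i \<omega>))" for \<omega>
  have [measurable]: "P \<in> borel_measurable M" unfolding P_def[abs_def] by measurable
  have P: "0 \<le> P \<omega>" "P \<omega> \<le> 1" for \<omega> unfolding P_def by (auto intro!: prod_nonneg prod_le_1)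
  have C: "expectation (\<lambda>\<omega>. W \<omega> * cos (a * Y k \<omega>) * P \<omega>) = 0" for a
    unfolding P_def using cc[of a] cs[of a] bound
    by (intro insert.IH) (auto simp: S_def abs_mult intro!: mult_le_one)
  have D: "expectation (\<lambda>\<omega>. W \<omega> * sin (a * Y k \<omega>) * P \<omega>) = 0" for a
    unfolding P_def using sc[of a] ss[of a] bound
    by (intro insert.IH) (auto simp: S_def abs_mult intro!: mult_le_one)
  have "expectation (\<lambda>\<omega>. (W \<omega> * P \<omega>) * indicator (B k) (Y k \<omega>)) = 0"
    using C D bound P
    by (intro expectation_indicator_eq_0_of_fourier) (auto simp: abs_mult mult_ac intro!: mult_le_one)
  then show ?case using insert.hyps unfolding P_def by (simp add: mult_ac)
qed

text \<open>
  Open boxes are cylinders over the coordinates, and the laws of \<open>Y\<close> under the original and the tilted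
  probability are determined by their values on boxes.
\<close>

lemma expectation_vimage_eq_0_of_fourier:
  fixes W :: "'a \<Rightarrow> real" and Y :: "'a \<Rightarrow> 'b::euclidean_space"
  assumes [measurable]: "W \<in> borel_measurable M" "Y \<in> borel_measurable M" "B \<in> sets borel"
    and bound: "\<And>\<omega>. \<bar>W \<omega>\<bar> \<le> 1"
    and cos: "\<And>t. expectation (\<lambda>\<omega>. W \<omega> * cos (inner t (Y \<omega>))) = 0"
    and sin: "\<And>t. expectation (\<lambda>\<omega>. W \<omega> * sin (inner t (Y \<omega>))) = 0"
  shows "expectation (\<lambda>\<omega>. W \<omega> * indicator B (Y \<omega>)) = 0"
proof -
  define Q where "Q = distr (density M (\<lambda>\<omega>. ennreal (1 + W \<omega>))) borel Y"
  have mean: "expectation W = 0" using cos[of 0] by simp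
  note Q = tilted_measure[OF assms(1,2) bound mean, folded Q_def]
  interpret D: prob_space "distr M borel Y" by (rule prob_space_distr) simp
  interpret Q: prob_space Q by (rule Q(1))
  have ip: "(\<Sum>i\<in>Basis. t i * inner (Y \<omega>) i) = inner (\<Sum>i\<in>Basis. t i *\<^sub>R i) (Y \<omega>)" for t \<omega>
    by (simp add: inner_sum_left inner_commute[of "Y \<omega>"])
  have box0: "expectation (\<lambda>\<omega>. W \<omega> * indicator (box l u) (Y \<omega>)) = 0" for l u
  proof -
    have "expectation (\<lambda>\<omega>. W \<omega> * (\<Prod>i\<in>Basis. indicator {inner l i<..<inner u i} (inner (Y \<omega>) i))) = 0"
      using bound cos sin
      by (intro expectation_cylinder_eq_0_of_fourier) (auto simp: ip)
    moreover have "(\<Prod>i\<in>Basis. indicat_real {inner l i<..<inner u i} (inner (Y \<omega>) i)) = indicator (box l u) (Y \<omega>)" for \<omega>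
      by (auto simp: indicator_def mem_box prod_zero_iff)
    ultimately show ?thesis by simp
  qed
  have "Q = distr M borel Y"
  proof (rule measure_eqI_generator_eq)
    let ?E = "range (\<lambda>(a, b). box a b :: 'b set)"
    show "Int_stable ?E" by (auto simp: Int_stable_def box_Int_box)
    show "?E \<subseteq> Pow UNIV" "sets Q = sigma_sets UNIV ?E" "sets (distr M borel Y) = sigma_sets UNIV ?E"
      by (simp_all add: borel_eq_box Q(2))
    let ?A = "\<lambda>n::nat. box (- (real n *\<^sub>R One)) (real n *\<^sub>R One) :: 'b set"
    show "range ?A \<subseteq> ?E" "(\<Union>i. ?A i) = UNIV" unfolding UN_box_eq_UNIV by auto
    show "emeasure Q (?A i) \<noteq> \<infinity>" for i
      by (simp add: Q.emeasure_eq_measure)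
    show "emeasure Q X = emeasure (distr M borel Y) X" if "X \<in> ?E" for X
      using that by (auto simp: Q(3) box0 D.emeasure_eq_measure Q.emeasure_eq_measure)
  qed
  then show ?thesis using Q(3)[of B] by simp
qed

end

section \<open>Mean-square estimation\<close>

context prob_space
begin

text \<open>
  For centred and jointly Gaussian variables the hypothesis expresses that \<open>Z\<close> and \<open>Y\<close> are uncorrelated. Subtracting
  the two sides and expanding leaves \<open>sin (a Z)\<close> orthogonal to \<open>cos (t \<bullet> Y)\<close> and \<open>sin (t \<bullet> Y)\<close> for all \<open>t\<close>,
  hence to the events of \<open>Y\<close>; dividing by \<open>a\<close> and letting \<open>a\<close> tend to \<open>0\<close> replaces \<open>sin (a Z)\<close> by \<open>Z\<close>.
\<close>

lemma expectation_vimage_eq_0_of_even: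
  fixes Z :: "'a \<Rightarrow> real" and Y :: "'a \<Rightarrow> 'b::euclidean_space"
  assumes Z: "integrable M Z" and [measurable]: "Y \<in> borel_measurable M" "B \<in> sets borel"
    and even: "\<And>a t. (\<integral>\<omega>. iexp (a * Z \<omega> + inner t (Y \<omega>)) \<partial>M) = (\<integral>\<omega>. iexp (- a * Z \<omega> + inner t (Y \<omega>)) \<partial>M)"
  shows "expectation (\<lambda>\<omega>. Z \<omega> * indicator B (Y \<omega>)) = 0"
proof -
  have [measurable]: "Z \<in> borel_measurable M" using Z by simp
  have i: "integrable M (\<lambda>\<omega>. iexp (a * Z \<omega> + inner t (Y \<omega>)))" for a t
    by (rule integrable_const_bound[of _ 1]) (auto simp del: of_real_add of_real_mult)
  have ic: "integrable M (\<lambda>\<omega>. cos (a * Z \<omega> + inner t (Y \<omega>)))" for a t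
    by (rule integrable_const_bound[of _ 1]) auto
  have isin: "integrable M (\<lambda>\<omega>. sin (a * Z \<omega> + inner t (Y \<omega>)))" for a t
    by (rule integrable_const_bound[of _ 1]) auto
  have ecos: "expectation (\<lambda>\<omega>. cos (a * Z \<omega> + inner t (Y \<omega>))) = expectation (\<lambda>\<omega>. cos (- a * Z \<omega> + inner t (Y \<omega>)))" for a t
    using arg_cong[OF even[of a t], of Re]
    by (subst (asm) (1 2) integral_Re[OF i, symmetric]) (simp add: Re_exp del: of_real_add of_real_mult)
  have esin: "expectation (\<lambda>\<omega>. sin (a * Z \<omega> + inner t (Y \<omega>))) = expectation (\<lambda>\<omega>. sin (- a * Z \<omega> + inner t (Y \<omega>)))" for a t
    using arg_cong[OF even[of a t], of Im]
    by (subst (asm) (1 2) integral_Im[OF i, symmetric]) (simp add: Im_exp del: of_real_add of_real_mult)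
  have c: "expectation (\<lambda>\<omega>. sin (a * Z \<omega>) * cos (inner t (Y \<omega>))) = 0" for a t
  proof -
    have "expectation (\<lambda>\<omega>. sin (a * Z \<omega>) * cos (inner t (Y \<omega>))) =
        expectation (\<lambda>\<omega>. (sin (a * Z \<omega> + inner t (Y \<omega>)) - sin (- a * Z \<omega> + inner t (Y \<omega>))) / 2)"
      by (intro Bochner_Integration.integral_cong) (auto simp: sin_add sin_diff)
    also have "\<dots> = (expectation (\<lambda>\<omega>. sin (a * Z \<omega> + inner t (Y \<omega>))) -
        expectation (\<lambda>\<omega>. sin (- a * Z \<omega> + inner t (Y \<omega>)))) / 2"
      by (simp only: integral_divide_zero Bochner_Integration.integral_diff[OF isin isin])
    also have "\<dots> = 0" by (simp only: esin[of a t] diff_self div_0)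
    finally show ?thesis .
  qed
  have s: "expectation (\<lambda>\<omega>. sin (a * Z \<omega>) * sin (inner t (Y \<omega>))) = 0" for a t
  proof -
    have "expectation (\<lambda>\<omega>. sin (a * Z \<omega>) * sin (inner t (Y \<omega>))) =
        expectation (\<lambda>\<omega>. (cos (- a * Z \<omega> + inner t (Y \<omega>)) - cos (a * Z \<omega> + inner t (Y \<omega>))) / 2)"
      by (intro Bochner_Integration.integral_cong) (auto simp: cos_add cos_diff)
    also have "\<dots> = (expectation (\<lambda>\<omega>. cos (- a * Z \<omega> + inner t (Y \<omega>))) -
        expectation (\<lambda>\<omega>. cos (a * Z \<omega> + inner t (Y \<omega>)))) / 2"
      by (simp only: integral_divide_zero Bochner_Integration.integral_diff[OF ic ic])
    also have "\<dots> = 0" by (simp only: ecos[of a t] diff_self div_0)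
    finally show ?thesis .
  qed
  have sin0: "expectation (\<lambda>\<omega>. sin (a * Z \<omega>) * indicator B (Y \<omega>)) = 0" for a
    using c[of a] s[of a] by (intro expectation_vimage_eq_0_of_fourier) auto
  have lim: "(\<lambda>n. expectation (\<lambda>\<omega>. real (Suc n) * sin (inverse (real (Suc n)) * Z \<omega>) * indicator B (Y \<omega>)))
      \<longlonglongrightarrow> expectation (\<lambda>\<omega>. Z \<omega> * indicator B (Y \<omega>))"
  proof (rule integral_dominated_convergence[where w = "\<lambda>\<omega>. \<bar>Z \<omega>\<bar>"])
    have "(\<lambda>n. real (Suc n) * sin (inverse (real (Suc n)) * z)) \<longlonglongrightarrow> z" for z :: real
    proof -
      have "((\<lambda>h. (sin (0 + h * z) - sin 0) / h) \<longlongrightarrow> z) (at 0)"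
      proof -
        have "((\<lambda>h. sin (h * z)) has_field_derivative z) (at 0)"
          by (auto intro!: derivative_eq_intros)
        then show ?thesis by (simp add: has_field_derivative_iff)
      qed
      then have "(\<lambda>n. (sin (0 + inverse (real (Suc n)) * z) - sin 0) / inverse (real (Suc n))) \<longlonglongrightarrow> z"
        by (rule filterlim_compose)
          (auto simp: filterlim_at LIMSEQ_inverse_real_of_nat simp del: of_nat_Suc)
      then show ?thesis by (simp add: field_simps)
    qed
    then show "AE \<omega> in M. (\<lambda>n. real (Suc n) * sin (inverse (real (Suc n)) * Z \<omega>) * indicator B (Y \<omega>))
        \<longlonglongrightarrow> Z \<omega> * indicator B (Y \<omega>)"
      by (intro AE_I2 tendsto_mult tendsto_const)
    show "AE \<omega> in M. norm (real (Suc n) * sin (inverse (real (Suc n)) * Z \<omega>) * indicator B (Y \<omega>)) \<le> \<bar>Z \<omega>\<bar>" for n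
    proof (rule AE_I2)
      fix \<omega>
      have "real (Suc n) * \<bar>sin (inverse (real (Suc n)) * Z \<omega>)\<bar> \<le> real (Suc n) * \<bar>inverse (real (Suc n)) * Z \<omega>\<bar>"
        by (intro mult_left_mono abs_sin_x_le_abs_x) auto
      also have "\<dots> = \<bar>Z \<omega>\<bar>" by (simp add: abs_mult)
      finally show "norm (real (Suc n) * sin (inverse (real (Suc n)) * Z \<omega>) * indicator B (Y \<omega>)) \<le> \<bar>Z \<omega>\<bar>"
        by (simp add: abs_mult indicator_def)
    qed
  qed (use Z in auto)
  have "expectation (\<lambda>\<omega>. real (Suc n) * sin (inverse (real (Suc n)) * Z \<omega>) * indicator B (Y \<omega>)) = 0" for n
    using sin0[of "inverse (real (Suc n))"] by (simp add: mult.assoc del: of_nat_Suc)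
  with lim show ?thesis by (simp add: LIMSEQ_const_iff)
qed

lemma square_integrable_lincomb:
  fixes X X' :: "'a \<Rightarrow> real"
  assumes [measurable]: "X \<in> borel_measurable M" "X' \<in> borel_measurable M"
    and "integrable M (\<lambda>\<omega>. (X \<omega>)\<^sup>2)" "integrable M (\<lambda>\<omega>. (X' \<omega>)\<^sup>2)"
  shows "integrable M (\<lambda>\<omega>. (a * X \<omega> + b * X' \<omega>)\<^sup>2)"
    and "expectation (\<lambda>\<omega>. (a * X \<omega> + b * X' \<omega>)\<^sup>2)
      \<le> 2 * a\<^sup>2 * expectation (\<lambda>\<omega>. (X \<omega>)\<^sup>2) + 2 * b\<^sup>2 * expectation (\<lambda>\<omega>. (X' \<omega>)\<^sup>2)"
proof -
  have i: "integrable M (\<lambda>\<omega>. 2 * a\<^sup>2 * (X \<omega>)\<^sup>2 + 2 * b\<^sup>2 * (X' \<omega>)\<^sup>2)" using assms by auto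
  have le: "(a * x + b * y)\<^sup>2 \<le> 2 * a\<^sup>2 * x\<^sup>2 + 2 * b\<^sup>2 * y\<^sup>2" for x y :: real
    using zero_le_power2[of "a * x - b * y"] by (simp add: power2_eq_square algebra_simps)
  show sq: "integrable M (\<lambda>\<omega>. (a * X \<omega> + b * X' \<omega>)\<^sup>2)"
    by (rule Bochner_Integration.integrable_bound[OF i]) (auto intro!: AE_I2 le abs_ge_self[THEN order_trans[rotated]] order_trans[OF le])
  have "expectation (\<lambda>\<omega>. (a * X \<omega> + b * X' \<omega>)\<^sup>2) \<le> expectation (\<lambda>\<omega>. 2 * a\<^sup>2 * (X \<omega>)\<^sup>2 + 2 * b\<^sup>2 * (X' \<omega>)\<^sup>2)"
    by (rule integral_mono[OF sq i le])
  then show "expectation (\<lambda>\<omega>. (a * X \<omega> + b * X' \<omega>)\<^sup>2)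
      \<le> 2 * a\<^sup>2 * expectation (\<lambda>\<omega>. (X \<omega>)\<^sup>2) + 2 * b\<^sup>2 * expectation (\<lambda>\<omega>. (X' \<omega>)\<^sup>2)"
    using assms by simp
qed

lemma square_integrable_mult:
  fixes X X' :: "'a \<Rightarrow> real"
  assumes [measurable]: "X \<in> borel_measurable M" "X' \<in> borel_measurable M"
    and "integrable M (\<lambda>\<omega>. (X \<omega>)\<^sup>2)" "integrable M (\<lambda>\<omega>. (X' \<omega>)\<^sup>2)"
  shows "integrable M (\<lambda>\<omega>. X \<omega> * X' \<omega>)"
proof (rule Bochner_Integration.integrable_bound)
  show "integrable M (\<lambda>\<omega>. (X \<omega>)\<^sup>2 + (X' \<omega>)\<^sup>2)" using assms by auto
  have "\<bar>x * y\<bar> \<le> x\<^sup>2 + y\<^sup>2" for x y :: real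
    using zero_le_power2[of "x - y"] zero_le_power2[of "x + y"] zero_le_power2[of x] zero_le_power2[of y]
    by (auto simp: power2_eq_square algebra_simps abs_if simp del: zero_le_power2)
  then show "AE \<omega> in M. norm (X \<omega> * X' \<omega>) \<le> norm ((X \<omega>)\<^sup>2 + (X' \<omega>)\<^sup>2)"
    by (auto intro!: AE_I2 order_trans[OF _ abs_ge_self])
qed measurable

text \<open>
  Orthogonality of the residual to the events of \<open>Y\<close> is the defining property of the conditional
  expectation. It extends to all square integrable functions of \<open>Y\<close>, which gives the Pythagorean identity
  \<open>E (X - S(Y))\<^sup>2 = E (X - T(Y))\<^sup>2 + E (S(Y) - T(Y))\<^sup>2\<close> for every competitor \<open>S\<close> of finite error.
\<close>

lemma mmse_of_orthogonal_residual:
  fixes X :: "'a \<Rightarrow> real" and Y :: "'a \<Rightarrow> 'y::topological_space"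
  assumes [measurable]: "X \<in> borel_measurable M" "Y \<in> borel_measurable M" "T \<in> borel_measurable borel"
    and X2: "integrable M (\<lambda>\<omega>. (X \<omega>)\<^sup>2)" and T2: "integrable M (\<lambda>\<omega>. (T (Y \<omega>))\<^sup>2)"
    and orth: "\<And>B. B \<in> sets borel \<Longrightarrow> expectation (\<lambda>\<omega>. (X \<omega> - T (Y \<omega>)) * indicator B (Y \<omega>)) = 0"
  shows "mmse_estimator M X Y T" and "cond_exp_given M X Y T"
    and "\<And>S. mmse_estimator M X Y S \<Longrightarrow> AE \<omega> in M. S (Y \<omega>) = T (Y \<omega>)"
proof -
  define F where "F = vimage_algebra (space M) Y borel"
  have sets_F: "sets F = {Y -` B \<inter> space M |B. B \<in> sets borel}"
    unfolding F_def by (rule sets_vimage_algebra2) auto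
  have YF[measurable]: "Y \<in> borel_measurable F"
    unfolding F_def by (rule measurable_vimage_algebra1) auto
  have "subalgebra M F" unfolding subalgebra_def sets_F by (auto simp: F_def)
  then interpret finite_measure_subalgebra M F
    by (intro finite_measure_subalgebra.intro finite_measure_subalgebra_axioms.intro finite_measure_axioms)
  have int_X: "integrable M X" by (rule square_integrable_imp_integrable[OF _ X2]) simp
  have int_T: "integrable M (\<lambda>\<omega>. T (Y \<omega>))" by (rule square_integrable_imp_integrable[OF _ T2]) simp
  define Z where "Z \<omega> = X \<omega> - T (Y \<omega>)" for \<omega>
  have Zm[measurable]: "Z \<in> borel_measurable M" unfolding Z_def[abs_def] by measurable
  have int_Z: "integrable M Z" unfolding Z_def[abs_def] using int_X int_T by auto
  have Z2: "integrable M (\<lambda>\<omega>. (Z \<omega>)\<^sup>2)"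
    using square_integrable_lincomb(1)[of X "\<lambda>\<omega>. T (Y \<omega>)" 1 "- 1"] X2 T2 unfolding Z_def by simp
  have zero: "(\<integral>\<omega>\<in>A. Z \<omega> \<partial>M) = 0" if "A \<in> sets F" for A
  proof -
    from that obtain B where B: "B \<in> sets borel" "A = Y -` B \<inter> space M" unfolding sets_F by auto
    have "(\<integral>\<omega>\<in>A. Z \<omega> \<partial>M) = expectation (\<lambda>\<omega>. Z \<omega> * indicator B (Y \<omega>))"
      unfolding set_lebesgue_integral_def B(2) by (intro Bochner_Integration.integral_cong) (auto simp: indicator_def)
    then show ?thesis using orth[OF B(1)] unfolding Z_def by simp
  qed
  have ceX: "AE \<omega> in M. real_cond_exp M F X \<omega> = T (Y \<omega>)"
  proof (rule real_cond_exp_charact)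
    show "(\<integral>\<omega>\<in>A. X \<omega> \<partial>M) = (\<integral>\<omega>\<in>A. T (Y \<omega>) \<partial>M)" if A: "A \<in> sets F" for A
    proof -
      have AM: "A \<in> sets M" using A \<open>subalgebra M F\<close> unfolding subalgebra_def by auto
      have "(\<integral>\<omega>\<in>A. Z \<omega> \<partial>M) = (\<integral>\<omega>\<in>A. X \<omega> \<partial>M) - (\<integral>\<omega>\<in>A. T (Y \<omega>) \<partial>M)"
        unfolding Z_def using integrable_mult_indicator[OF AM int_X] integrable_mult_indicator[OF AM int_T]
        by (intro set_integral_diff) (auto simp: set_integrable_def)
      then show ?thesis using zero[OF A] by simp
    qed
  qed (use int_X int_T in measurable)
  then show "cond_exp_given M X Y T" unfolding cond_exp_given_def F_def by simp
  have ceZ: "AE \<omega> in M. real_cond_exp M F Z \<omega> = 0"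
    by (rule real_cond_exp_charact) (use zero int_Z in \<open>auto simp: set_lebesgue_integral_def\<close>)
  have cross: "expectation (\<lambda>\<omega>. D (Y \<omega>) * Z \<omega>) = 0"
    if [measurable]: "D \<in> borel_measurable borel" and D2: "integrable M (\<lambda>\<omega>. (D (Y \<omega>))\<^sup>2)" for D
  proof -
    have "expectation (\<lambda>\<omega>. D (Y \<omega>) * Z \<omega>) = expectation (\<lambda>\<omega>. D (Y \<omega>) * real_cond_exp M F Z \<omega>)"
      using D2 Z2 by (intro real_cond_exp_intg(2)[symmetric] square_integrable_mult) auto
    also have "\<dots> = expectation (\<lambda>\<omega>. 0)" by (intro integral_cong_AE) (use ceZ in auto)
    finally show ?thesis by simp
  qed
  have pythagoras: "integrable M (\<lambda>\<omega>. (S (Y \<omega>) - T (Y \<omega>))\<^sup>2)"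
      "expectation (\<lambda>\<omega>. (X \<omega> - S (Y \<omega>))\<^sup>2) = expectation (\<lambda>\<omega>. (Z \<omega>)\<^sup>2) + expectation (\<lambda>\<omega>. (S (Y \<omega>) - T (Y \<omega>))\<^sup>2)"
    if [measurable]: "S \<in> borel_measurable borel" and S2: "integrable M (\<lambda>\<omega>. (X \<omega> - S (Y \<omega>))\<^sup>2)" for S
  proof -
    define D where "D y = S y - T y" for y
    have Dm[measurable]: "D \<in> borel_measurable borel" unfolding D_def[abs_def] by measurable
    have D2: "integrable M (\<lambda>\<omega>. (D (Y \<omega>))\<^sup>2)"
      using square_integrable_lincomb(1)[of Z "\<lambda>\<omega>. X \<omega> - S (Y \<omega>)" 1 "- 1"] Z2 S2 unfolding Z_def D_def by simp
    have DZ: "integrable M (\<lambda>\<omega>. D (Y \<omega>) * Z \<omega>)" using D2 Z2 by (intro square_integrable_mult) auto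
    have "(\<lambda>\<omega>. (X \<omega> - S (Y \<omega>))\<^sup>2) = (\<lambda>\<omega>. (Z \<omega>)\<^sup>2 - 2 * (D (Y \<omega>) * Z \<omega>) + (D (Y \<omega>))\<^sup>2)"
      unfolding Z_def D_def by (simp add: power2_eq_square algebra_simps)
    then have "expectation (\<lambda>\<omega>. (X \<omega> - S (Y \<omega>))\<^sup>2) = expectation (\<lambda>\<omega>. (Z \<omega>)\<^sup>2) + expectation (\<lambda>\<omega>. (D (Y \<omega>))\<^sup>2)"
      using Z2 D2 DZ cross[OF Dm D2] by simp
    then show "integrable M (\<lambda>\<omega>. (S (Y \<omega>) - T (Y \<omega>))\<^sup>2)"
      "expectation (\<lambda>\<omega>. (X \<omega> - S (Y \<omega>))\<^sup>2) = expectation (\<lambda>\<omega>. (Z \<omega>)\<^sup>2) + expectation (\<lambda>\<omega>. (S (Y \<omega>) - T (Y \<omega>))\<^sup>2)"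
      using D2 unfolding D_def by auto
  qed
  have finite_mse: "integrable M (\<lambda>\<omega>. (X \<omega> - S (Y \<omega>))\<^sup>2)"
      "(\<integral>\<^sup>+\<omega>. ennreal ((X \<omega> - S (Y \<omega>))\<^sup>2) \<partial>M) = ennreal (expectation (\<lambda>\<omega>. (X \<omega> - S (Y \<omega>))\<^sup>2))"
    if [measurable]: "S \<in> borel_measurable borel" and "(\<integral>\<^sup>+\<omega>. ennreal ((X \<omega> - S (Y \<omega>))\<^sup>2) \<partial>M) < \<infinity>" for S
  proof -
    show i: "integrable M (\<lambda>\<omega>. (X \<omega> - S (Y \<omega>))\<^sup>2)"
      using that by (intro integrableI_bounded) auto
    show "(\<integral>\<^sup>+\<omega>. ennreal ((X \<omega> - S (Y \<omega>))\<^sup>2) \<partial>M) = ennreal (expectation (\<lambda>\<omega>. (X \<omega> - S (Y \<omega>))\<^sup>2))"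
      by (rule nn_integral_eq_integral[OF i]) auto
  qed
  have mse_T: "(\<integral>\<^sup>+\<omega>. ennreal ((X \<omega> - T (Y \<omega>))\<^sup>2) \<partial>M) = ennreal (expectation (\<lambda>\<omega>. (Z \<omega>)\<^sup>2))"
    unfolding Z_def[symmetric] by (rule nn_integral_eq_integral[OF Z2]) auto
  show "mmse_estimator M X Y T"
    unfolding mmse_estimator_def is_arg_min_linorder
  proof (intro conjI allI impI)
    fix S :: "'y \<Rightarrow> real" assume S: "S \<in> borel_measurable borel"
    show "(\<integral>\<^sup>+\<omega>. ennreal ((X \<omega> - T (Y \<omega>))\<^sup>2) \<partial>M) \<le> (\<integral>\<^sup>+\<omega>. ennreal ((X \<omega> - S (Y \<omega>))\<^sup>2) \<partial>M)"
    proof (cases "(\<integral>\<^sup>+\<omega>. ennreal ((X \<omega> - S (Y \<omega>))\<^sup>2) \<partial>M) < \<infinity>")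
      case True
      have "0 \<le> expectation (\<lambda>\<omega>. (S (Y \<omega>) - T (Y \<omega>))\<^sup>2)" by simp
      then show ?thesis
        unfolding mse_T finite_mse(2)[OF S True] pythagoras(2)[OF S finite_mse(1)[OF S True]]
        by (intro ennreal_leI) simp
    qed (auto simp: not_less top_unique)
  qed measurable
  show "AE \<omega> in M. S (Y \<omega>) = T (Y \<omega>)" if "mmse_estimator M X Y S" for S
  proof -
    from that have S[measurable]: "S \<in> borel_measurable borel"
      and le: "(\<integral>\<^sup>+\<omega>. ennreal ((X \<omega> - S (Y \<omega>))\<^sup>2) \<partial>M) \<le> ennreal (expectation (\<lambda>\<omega>. (Z \<omega>)\<^sup>2))"
      unfolding mmse_estimator_def is_arg_min_linorder mse_T[symmetric] by auto
    then have fin: "(\<integral>\<^sup>+\<omega>. ennreal ((X \<omega> - S (Y \<omega>))\<^sup>2) \<partial>M) < \<infinity>"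
      using order_le_less_trans[OF le ennreal_less_top] by simp
    note p = pythagoras[OF S finite_mse(1)[OF S fin]]
    have "expectation (\<lambda>\<omega>. (S (Y \<omega>) - T (Y \<omega>))\<^sup>2) \<le> 0"
      using le unfolding finite_mse(2)[OF S fin] p(2) by (simp add: ennreal_le_iff)
    then have "expectation (\<lambda>\<omega>. (S (Y \<omega>) - T (Y \<omega>))\<^sup>2) = 0" by (simp add: order_antisym)
    then have "AE \<omega> in M. (S (Y \<omega>) - T (Y \<omega>))\<^sup>2 = 0"
      using integral_nonneg_eq_0_iff_AE[OF p(1)] by simp
    then show ?thesis by eventually_elim simp
  qed
qed

end

section \<open>Gaussian processes extended by continuity\<close>

lemma centered_gaussian_fourier:
  assumes "0 \<le> v"
  shows "(\<integral>x. iexp x \<partial>centered_gaussian v) = exp (- v / 2)"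
    and "integrable (centered_gaussian v) (\<lambda>x. x\<^sup>2)"
proof -
  have "(\<integral>x. iexp x \<partial>centered_gaussian v) = exp (- v / 2) \<and> integrable (centered_gaussian v) (\<lambda>x. x\<^sup>2)"
  proof (cases "v = 0")
    case True
    have "integrable (return borel (0::real)) (\<lambda>x. x\<^sup>2)"
      by (subst integrable_iff_bounded) (auto simp: nn_integral_return)
    then show ?thesis using True by (simp add: centered_gaussian_def integral_return)
  next
    case False
    then have v: "sqrt v > 0" using assms by simp
    interpret std: prob_space std_normal_distribution by (rule prob_space_normal_density) simp
    have "distributed std_normal_distribution lborel (\<lambda>x. x) std_normal_density"
      unfolding distributed_def by (auto simp: distr_id2)
    from std.normal_density_affine[OF this, of "sqrt v" 0] v
    have "distr std_normal_distribution lborel (\<lambda>x. sqrt v * x) = density lborel (normal_density 0 (sqrt v))"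
      by (auto simp: distributed_def)
    moreover have "distr std_normal_distribution borel (\<lambda>x. sqrt v * x) = distr std_normal_distribution lborel (\<lambda>x. sqrt v * x)"
      by (intro distr_cong) auto
    ultimately have d: "distr std_normal_distribution borel (\<lambda>x. sqrt v * x) = centered_gaussian v"
      using False by (simp add: centered_gaussian_def)
    have "(\<integral>x. iexp x \<partial>centered_gaussian v) = char std_normal_distribution (sqrt v)"
      unfolding d[symmetric] char_def by (subst integral_distr) auto
    also have "\<dots> = exp (- v / 2)" using assms by (simp add: char_std_normal_distribution)
    finally have "(\<integral>x. iexp x \<partial>centered_gaussian v) = exp (- v / 2)" .
    moreover have "integrable (centered_gaussian v) (\<lambda>x. x\<^sup>2)"
      using False integrable_normal_moment[of "sqrt v" 0 2] v
      by (simp add: centered_gaussian_def integrable_density)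
    ultimately show ?thesis by blast
  qed
  then show "(\<integral>x. iexp x \<partial>centered_gaussian v) = exp (- v / 2)" "integrable (centered_gaussian v) (\<lambda>x. x\<^sup>2)"
    by auto
qed

context prob_space
begin

lemma gaussian_variable:
  assumes [measurable]: "X \<in> borel_measurable M" and law: "distr M borel X = centered_gaussian v" and v: "0 \<le> v"
  shows "(\<integral>\<omega>. iexp (X \<omega>) \<partial>M) = exp (- v / 2)" and "integrable M (\<lambda>\<omega>. (X \<omega>)\<^sup>2)"
proof -
  have "(\<integral>\<omega>. iexp (X \<omega>) \<partial>M) = (\<integral>x. iexp x \<partial>distr M borel X)" by (subst integral_distr) auto
  then show "(\<integral>\<omega>. iexp (X \<omega>) \<partial>M) = exp (- v / 2)" unfolding law by (simp add: centered_gaussian_fourier[OF v])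
  have "integrable (distr M borel X) (\<lambda>x. x\<^sup>2)" unfolding law by (rule centered_gaussian_fourier(2)[OF v])
  then show "integrable M (\<lambda>\<omega>. (X \<omega>)\<^sup>2)" by (subst (asm) integrable_distr_eq) auto
qed

lemma square_integrable_sum:
  fixes X :: "'i \<Rightarrow> 'a \<Rightarrow> real"
  assumes "finite I" and "\<And>i. i \<in> I \<Longrightarrow> X i \<in> borel_measurable M"
    and "\<And>i. i \<in> I \<Longrightarrow> integrable M (\<lambda>\<omega>. (X i \<omega>)\<^sup>2)"
  shows "integrable M (\<lambda>\<omega>. (\<Sum>i\<in>I. c i * X i \<omega>)\<^sup>2)"
  using assms
proof (induction I rule: finite_induct)
  case (insert k I)
  then show ?case
    using square_integrable_lincomb(1)[of "X k" "\<lambda>\<omega>. \<Sum>i\<in>I. c i * X i \<omega>" "c k" 1] by simp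
qed simp

lemma norm_iexp_diff_le: "norm (iexp x - iexp y) \<le> \<bar>x - y\<bar>"
proof -
  have "iexp x - iexp y = iexp y * (iexp (x - y) - 1)"
    by (simp add: exp_add[symmetric] algebra_simps)
  then have "norm (iexp x - iexp y) = norm (iexp (x - y) - 1)" by (simp add: norm_mult)
  also have "\<dots> \<le> \<bar>x - y\<bar>" using iexp_approx1[of "x - y" 0] by simp
  finally show ?thesis .
qed

lemma abs_expectation_le_sqrt:
  fixes D :: "'a \<Rightarrow> real"
  assumes [measurable]: "D \<in> borel_measurable M" and D2: "integrable M (\<lambda>\<omega>. (D \<omega>)\<^sup>2)"
  shows "integrable M D" and "expectation (\<lambda>\<omega>. \<bar>D \<omega>\<bar>) \<le> sqrt (expectation (\<lambda>\<omega>. (D \<omega>)\<^sup>2))"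
proof -
  show i: "integrable M D" by (rule square_integrable_imp_integrable[OF _ D2]) simp
  have "0 \<le> variance (\<lambda>\<omega>. \<bar>D \<omega>\<bar>)" by (rule variance_positive)
  also have "\<dots> = expectation (\<lambda>\<omega>. \<bar>D \<omega>\<bar>\<^sup>2) - (expectation (\<lambda>\<omega>. \<bar>D \<omega>\<bar>))\<^sup>2"
    using i D2 by (intro variance_eq) auto
  finally show "expectation (\<lambda>\<omega>. \<bar>D \<omega>\<bar>) \<le> sqrt (expectation (\<lambda>\<omega>. (D \<omega>)\<^sup>2))"
    by (intro real_le_rsqrt) simp
qed

end

text \<open>
  A centred Gaussian process indexed by a vector space, whose covariance is given by a linear map \<open>K\<close> into
  an inner product space. Linearity in the index makes the laws of the single variables determine all joint laws.
\<close>

locale linear_gaussian_process = prob_space M for M :: "'w measure" +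
  fixes X :: "'s::real_vector \<Rightarrow> 'w \<Rightarrow> real" and K :: "'s \<Rightarrow> 'l::real_inner"
  assumes linear_K: "linear K"
    and X_measurable[measurable]: "\<And>\<phi>. X \<phi> \<in> borel_measurable M"
    and X_linear: "\<And>\<omega>. linear (\<lambda>\<phi>. X \<phi> \<omega>)"
    and X_law: "\<And>\<phi>. distr M borel (X \<phi>) = centered_gaussian ((norm (K \<phi>))\<^sup>2)"
begin

text \<open>
  \<open>Z\<close> is a version of the value at \<open>v\<close> of the process, extended from the range of \<open>K\<close> by continuity.
\<close>

definition mean_square_limit :: "'l \<Rightarrow> ('w \<Rightarrow> real) \<Rightarrow> bool" where
  "mean_square_limit v Z \<longleftrightarrow> Z \<in> borel_measurable M \<and> integrable M (\<lambda>\<omega>. (Z \<omega>)\<^sup>2) \<and>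
     (\<exists>\<psi>::nat \<Rightarrow> 's. (\<lambda>n. K (\<psi> n)) \<longlonglongrightarrow> v \<and> (\<lambda>n. expectation (\<lambda>\<omega>. (X (\<psi> n) \<omega> - Z \<omega>)\<^sup>2)) \<longlonglongrightarrow> 0)"

lemma X_fourier: "(\<integral>\<omega>. iexp (X \<phi> \<omega>) \<partial>M) = exp (- (norm (K \<phi>))\<^sup>2 / 2)"
  and X_square_integrable: "integrable M (\<lambda>\<omega>. (X \<phi> \<omega>)\<^sup>2)"
  using gaussian_variable[OF X_measurable X_law] by auto

lemma error_square_integrable:
  assumes "mean_square_limit v Z"
  shows "integrable M (\<lambda>\<omega>. (X \<phi> \<omega> - Z \<omega>)\<^sup>2)"
  using square_integrable_lincomb(1)[of "X \<phi>" Z 1 "- 1"] X_square_integrable assms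
  by (simp add: mean_square_limit_def)

lemma mean_square_limit_lincomb:
  assumes Z: "mean_square_limit v Z" and Z': "mean_square_limit v' Z'"
  shows "mean_square_limit (a *\<^sub>R v + b *\<^sub>R v') (\<lambda>\<omega>. a * Z \<omega> + b * Z' \<omega>)"
proof -
  have [measurable]: "Z \<in> borel_measurable M" "Z' \<in> borel_measurable M"
    and sq: "integrable M (\<lambda>\<omega>. (Z \<omega>)\<^sup>2)" "integrable M (\<lambda>\<omega>. (Z' \<omega>)\<^sup>2)"
    using Z Z' unfolding mean_square_limit_def by auto
  from Z obtain \<psi> :: "nat \<Rightarrow> 's" where \<psi>: "(\<lambda>n. K (\<psi> n)) \<longlonglongrightarrow> v"
    "(\<lambda>n. expectation (\<lambda>\<omega>. (X (\<psi> n) \<omega> - Z \<omega>)\<^sup>2)) \<longlonglongrightarrow> 0" unfolding mean_square_limit_def by auto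
  from Z' obtain \<psi>' :: "nat \<Rightarrow> 's" where \<psi>': "(\<lambda>n. K (\<psi>' n)) \<longlonglongrightarrow> v'"
    "(\<lambda>n. expectation (\<lambda>\<omega>. (X (\<psi>' n) \<omega> - Z' \<omega>)\<^sup>2)) \<longlonglongrightarrow> 0" unfolding mean_square_limit_def by auto
  define \<xi> where "\<xi> n = a *\<^sub>R \<psi> n + b *\<^sub>R \<psi>' n" for n
  have "(\<lambda>n. K (\<xi> n)) \<longlonglongrightarrow> a *\<^sub>R v + b *\<^sub>R v'"
    unfolding \<xi>_def linear_add[OF linear_K] linear_scale[OF linear_K] by (intro tendsto_intros \<psi> \<psi>')
  moreover have "(\<lambda>n. expectation (\<lambda>\<omega>. (X (\<xi> n) \<omega> - (a * Z \<omega> + b * Z' \<omega>))\<^sup>2)) \<longlonglongrightarrow> 0"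
  proof (rule real_tendsto_sandwich[OF _ _ tendsto_const])
    show "\<forall>\<^sub>F n in sequentially. 0 \<le> expectation (\<lambda>\<omega>. (X (\<xi> n) \<omega> - (a * Z \<omega> + b * Z' \<omega>))\<^sup>2)"
      by (intro always_eventually allI integral_nonneg) simp
    have eq: "X (\<xi> n) \<omega> - (a * Z \<omega> + b * Z' \<omega>) = a * (X (\<psi> n) \<omega> - Z \<omega>) + b * (X (\<psi>' n) \<omega> - Z' \<omega>)" for n \<omega>
      unfolding \<xi>_def linear_add[OF X_linear] linear_scale[OF X_linear] by (simp add: algebra_simps)
    show "\<forall>\<^sub>F n in sequentially. expectation (\<lambda>\<omega>. (X (\<xi> n) \<omega> - (a * Z \<omega> + b * Z' \<omega>))\<^sup>2)
        \<le> 2 * a\<^sup>2 * expectation (\<lambda>\<omega>. (X (\<psi> n) \<omega> - Z \<omega>)\<^sup>2) + 2 * b\<^sup>2 * expectation (\<lambda>\<omega>. (X (\<psi>' n) \<omega> - Z' \<omega>)\<^sup>2)"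
      unfolding eq
      by (intro always_eventually allI square_integrable_lincomb(2) error_square_integrable[OF Z] error_square_integrable[OF Z'])
        measurable
    show "(\<lambda>n. 2 * a\<^sup>2 * expectation (\<lambda>\<omega>. (X (\<psi> n) \<omega> - Z \<omega>)\<^sup>2) + 2 * b\<^sup>2 * expectation (\<lambda>\<omega>. (X (\<psi>' n) \<omega> - Z' \<omega>)\<^sup>2))
        \<longlonglongrightarrow> 0"
      using tendsto_add[OF tendsto_mult_right_zero[OF \<psi>(2), of "2 * a\<^sup>2"] tendsto_mult_right_zero[OF \<psi>'(2), of "2 * b\<^sup>2"]]
      by simp
  qed
  ultimately show ?thesis
    unfolding mean_square_limit_def using square_integrable_lincomb(1)[OF _ _ sq, of a b] by auto
qed

lemma mean_square_limit_0: "mean_square_limit 0 (\<lambda>\<omega>. 0)"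
  unfolding mean_square_limit_def
  by (auto intro!: exI[of _ "\<lambda>n. 0"] simp: linear_0[OF linear_K] linear_0[OF X_linear])

lemma mean_square_limit_sum:
  assumes "finite I" and "\<And>i. i \<in> I \<Longrightarrow> mean_square_limit (v i) (Z i)"
  shows "mean_square_limit (\<Sum>i\<in>I. c i *\<^sub>R v i) (\<lambda>\<omega>. \<Sum>i\<in>I. c i * Z i \<omega>)"
  using assms
proof (induction I rule: finite_induct)
  case (insert k I)
  then show ?case
    using mean_square_limit_lincomb[of "v k" "Z k" "\<Sum>i\<in>I. c i *\<^sub>R v i" "\<lambda>\<omega>. \<Sum>i\<in>I. c i * Z i \<omega>" "c k" 1] by simp
qed (simp add: mean_square_limit_0)

text \<open>
  The formula holds for the variables \<open>X \<phi>\<close> by independence, and it survives the limit because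
  \<open>x \<mapsto> e\<^sup>i\<^sup>x\<close> is Lipschitz and mean-square convergence implies convergence in mean.
\<close>

lemma mean_square_limit_fourier:
  assumes Z: "mean_square_limit v Z" and indep: "\<And>\<phi>. indep_var borel (X \<phi>) borel N"
  shows "(\<integral>\<omega>. iexp (Z \<omega> + N \<omega>) \<partial>M) = exp (- (norm v)\<^sup>2 / 2) * (\<integral>\<omega>. iexp (N \<omega>) \<partial>M)"
proof -
  have [measurable]: "Z \<in> borel_measurable M" "N \<in> borel_measurable M"
    using Z indep_var_rv2[OF indep] unfolding mean_square_limit_def by auto
  from Z obtain \<psi> :: "nat \<Rightarrow> 's" where \<psi>: "(\<lambda>n. K (\<psi> n)) \<longlonglongrightarrow> v"
    "(\<lambda>n. expectation (\<lambda>\<omega>. (X (\<psi> n) \<omega> - Z \<omega>)\<^sup>2)) \<longlonglongrightarrow> 0" unfolding mean_square_limit_def by auto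
  have iexp_int: "integrable M (\<lambda>\<omega>. iexp (f \<omega>))" if [measurable]: "f \<in> borel_measurable M" for f :: "'w \<Rightarrow> real"
    by (rule integrable_const_bound[of _ 1]) auto
  have "(\<integral>\<omega>. iexp (X (\<psi> n) \<omega> + N \<omega>) \<partial>M) = exp (- (norm (K (\<psi> n)))\<^sup>2 / 2) * (\<integral>\<omega>. iexp (N \<omega>) \<partial>M)" for n
  proof -
    have "(\<integral>\<omega>. iexp (X (\<psi> n) \<omega> + N \<omega>) \<partial>M) = (\<integral>\<omega>. iexp (X (\<psi> n) \<omega>) * iexp (N \<omega>) \<partial>M)"
      by (simp add: exp_add distrib_left)
    also have "\<dots> = (\<integral>\<omega>. iexp (X (\<psi> n) \<omega>) \<partial>M) * (\<integral>\<omega>. iexp (N \<omega>) \<partial>M)"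
      by (intro indep_var_lebesgue_integral indep_var_compose[unfolded comp_def, OF indep] iexp_int) auto
    finally show ?thesis by (simp add: X_fourier)
  qed
  moreover have "(\<lambda>n. exp (- (norm (K (\<psi> n)))\<^sup>2 / 2) * (\<integral>\<omega>. iexp (N \<omega>) \<partial>M))
      \<longlonglongrightarrow> exp (- (norm v)\<^sup>2 / 2) * (\<integral>\<omega>. iexp (N \<omega>) \<partial>M)"
    by (intro tendsto_intros \<psi>(1)) auto
  ultimately have lim1: "(\<lambda>n. \<integral>\<omega>. iexp (X (\<psi> n) \<omega> + N \<omega>) \<partial>M) \<longlonglongrightarrow> exp (- (norm v)\<^sup>2 / 2) * (\<integral>\<omega>. iexp (N \<omega>) \<partial>M)"
    by simp
  have "(\<lambda>n. (\<integral>\<omega>. iexp (X (\<psi> n) \<omega> + N \<omega>) \<partial>M) - (\<integral>\<omega>. iexp (Z \<omega> + N \<omega>) \<partial>M)) \<longlonglongrightarrow> 0"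
  proof (rule Lim_null_comparison)
    have "norm ((\<integral>\<omega>. iexp (X (\<psi> n) \<omega> + N \<omega>) \<partial>M) - (\<integral>\<omega>. iexp (Z \<omega> + N \<omega>) \<partial>M))
        \<le> sqrt (expectation (\<lambda>\<omega>. (X (\<psi> n) \<omega> - Z \<omega>)\<^sup>2))" for n
    proof -
      have i: "integrable M (\<lambda>\<omega>. iexp (X (\<psi> n) \<omega> + N \<omega>))" "integrable M (\<lambda>\<omega>. iexp (Z \<omega> + N \<omega>))"
        by (rule iexp_int, measurable)+
      note D = abs_expectation_le_sqrt[OF _ error_square_integrable[OF Z, of "\<psi> n"]]
      have "norm ((\<integral>\<omega>. iexp (X (\<psi> n) \<omega> + N \<omega>) \<partial>M) - (\<integral>\<omega>. iexp (Z \<omega> + N \<omega>) \<partial>M))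
          = norm (\<integral>\<omega>. iexp (X (\<psi> n) \<omega> + N \<omega>) - iexp (Z \<omega> + N \<omega>) \<partial>M)"
        by (subst Bochner_Integration.integral_diff[OF i]) (rule refl)
      also have "\<dots> \<le> (\<integral>\<omega>. norm (iexp (X (\<psi> n) \<omega> + N \<omega>) - iexp (Z \<omega> + N \<omega>)) \<partial>M)"
        by (rule integral_norm_bound)
      also have "\<dots> \<le> expectation (\<lambda>\<omega>. \<bar>X (\<psi> n) \<omega> - Z \<omega>\<bar>)"
      proof (rule integral_mono)
        show "norm (iexp (X (\<psi> n) \<omega> + N \<omega>) - iexp (Z \<omega> + N \<omega>)) \<le> \<bar>X (\<psi> n) \<omega> - Z \<omega>\<bar>" for \<omega>
          using norm_iexp_diff_le[of "X (\<psi> n) \<omega> + N \<omega>" "Z \<omega> + N \<omega>"] by simp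
        show "integrable M (\<lambda>\<omega>. norm (iexp (X (\<psi> n) \<omega> + N \<omega>) - iexp (Z \<omega> + N \<omega>)))"
          by (intro integrable_norm Bochner_Integration.integrable_diff i)
        show "integrable M (\<lambda>\<omega>. \<bar>X (\<psi> n) \<omega> - Z \<omega>\<bar>)" by (intro integrable_abs D(1)) measurable
      qed
      also have "\<dots> \<le> sqrt (expectation (\<lambda>\<omega>. (X (\<psi> n) \<omega> - Z \<omega>)\<^sup>2))" by (rule D(2)) measurable
      finally show ?thesis .
    qed
    then show "\<forall>\<^sub>F n in sequentially. norm ((\<integral>\<omega>. iexp (X (\<psi> n) \<omega> + N \<omega>) \<partial>M) - (\<integral>\<omega>. iexp (Z \<omega> + N \<omega>) \<partial>M))
        \<le> sqrt (expectation (\<lambda>\<omega>. (X (\<psi> n) \<omega> - Z \<omega>)\<^sup>2))" by (intro always_eventually allI)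
    show "(\<lambda>n. sqrt (expectation (\<lambda>\<omega>. (X (\<psi> n) \<omega> - Z \<omega>)\<^sup>2))) \<longlonglongrightarrow> 0"
      using tendsto_real_sqrt[OF \<psi>(2)] by simp
  qed
  then have "(\<lambda>n. \<integral>\<omega>. iexp (X (\<psi> n) \<omega> + N \<omega>) \<partial>M) \<longlonglongrightarrow> (\<integral>\<omega>. iexp (Z \<omega> + N \<omega>) \<partial>M)"
    by (rule LIM_zero_cancel)
  with lim1 show ?thesis using LIMSEQ_unique by blast
qed

text \<open>
  The predictor is the linear form \<open>inner c\<close> with \<open>c = ridge_coeffs r lam b\<close>, where \<open>b\<close> is the vector of
  covariances of target and measurements. With the residual \<open>R\<close>, the characteristic function of
  \<open>a * R + inner t Y\<close> is \<open>exp (- q a t / 2)\<close> for a quadratic form \<open>q\<close>. The linear system that defines \<open>c\<close>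
  says exactly that \<open>q\<close> has no mixed term in \<open>a\<close> and \<open>t\<close>, so \<open>q\<close> is even in \<open>a\<close>.
\<close>

proposition ridge_predictor_mmse:
  fixes r :: "'m::finite \<Rightarrow> 'l" and \<epsilon> :: "'w \<Rightarrow> real ^ 'm"
  assumes Z: "\<And>m. mean_square_limit (r m) (Z m)" and Z0: "mean_square_limit v0 Z0" and lam: "lam > 0"
    and \<epsilon>[measurable]: "\<epsilon> \<in> borel_measurable M"
    and noise: "\<And>s. distr M borel (\<lambda>\<omega>. inner s (\<epsilon> \<omega>)) = centered_gaussian (lam * (norm s)\<^sup>2)"
    and indep: "\<And>\<phi> s. indep_var borel (X \<phi>) borel (\<lambda>\<omega>. inner s (\<epsilon> \<omega>))"
  defines "Y \<equiv> \<lambda>\<omega>. (\<chi> m. Z m \<omega>) + \<epsilon> \<omega>"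
    and "T \<equiv> \<lambda>y. inner v0 (\<Sum>m\<in>UNIV. ridge_coeffs r lam y $ m *\<^sub>R r m)"
  shows "mmse_estimator M Z0 Y T" and "cond_exp_given M Z0 Y T"
    and "\<And>S. mmse_estimator M Z0 Y S \<Longrightarrow> AE \<omega> in M. S (Y \<omega>) = T (Y \<omega>)"
proof -
  define b :: "real ^ 'm" where "b = (\<chi> m. inner v0 (r m))"
  define c where "c = ridge_coeffs r lam b"
  have T_eq: "T y = inner c y" for y
  proof -
    have "T y = inner b (ridge_coeffs r lam y)"
      unfolding T_def b_def by (simp add: inner_sum_right inner_vec_def mult.commute)
    then show ?thesis unfolding c_def using inner_ridge_coeffs[OF lam] by simp
  qed
  have Zm[measurable]: "Z m \<in> borel_measurable M" and Zsq: "integrable M (\<lambda>\<omega>. (Z m \<omega>)\<^sup>2)" for m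
    using Z unfolding mean_square_limit_def by auto
  have Z0_measurable[measurable]: "Z0 \<in> borel_measurable M" and Z0sq: "integrable M (\<lambda>\<omega>. (Z0 \<omega>)\<^sup>2)"
    using Z0 unfolding mean_square_limit_def by auto
  have inner_Y: "inner s (Y \<omega>) = (\<Sum>m\<in>UNIV. s $ m * Z m \<omega>) + inner s (\<epsilon> \<omega>)" for s \<omega>
    unfolding Y_def inner_add_right by (simp add: inner_vec_def)
  have Y_measurable[measurable]: "Y \<in> borel_measurable M"
  proof (subst borel_measurable_euclidean_space, intro ballI)
    fix i :: "real ^ 'm"
    show "(\<lambda>\<omega>. inner (Y \<omega>) i) \<in> borel_measurable M" unfolding inner_commute[of _ i] inner_Y by measurable
  qed
  have T_measurable[measurable]: "T \<in> borel_measurable borel" unfolding T_eq[abs_def] by measurable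
  have noise_nonneg: "0 \<le> lam * (norm s)\<^sup>2" for s :: "real ^ 'm" using lam by simp
  note noise_facts = gaussian_variable[OF _ noise noise_nonneg]
  have T2: "integrable M (\<lambda>\<omega>. (T (Y \<omega>))\<^sup>2)"
    using square_integrable_lincomb(1)[of "\<lambda>\<omega>. \<Sum>m\<in>UNIV. c $ m * Z m \<omega>" "\<lambda>\<omega>. inner c (\<epsilon> \<omega>)" 1 1]
      square_integrable_sum[of UNIV Z "\<lambda>m. c $ m"] Zsq noise_facts(2)[of c]
    unfolding T_eq inner_Y by simp
  define R where "R \<omega> = Z0 \<omega> - T (Y \<omega>)" for \<omega>
  have "integrable M Z0" by (rule square_integrable_imp_integrable[OF _ Z0sq]) measurable
  moreover have "integrable M (\<lambda>\<omega>. T (Y \<omega>))" by (rule square_integrable_imp_integrable[OF _ T2]) measurable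
  ultimately have R_int: "integrable M R" unfolding R_def[abs_def] by auto
  define q where "q a t = (norm (a *\<^sub>R v0 + (\<Sum>m\<in>UNIV. (t - a *\<^sub>R c) $ m *\<^sub>R r m)))\<^sup>2 + lam * (norm (t - a *\<^sub>R c))\<^sup>2" for a t
  have fourier: "(\<integral>\<omega>. iexp (a * R \<omega> + inner t (Y \<omega>)) \<partial>M) = exp (- q a t / 2)" for a t
  proof -
    define s where "s = t - a *\<^sub>R c"
    have lim: "mean_square_limit (a *\<^sub>R v0 + (\<Sum>m\<in>UNIV. s $ m *\<^sub>R r m)) (\<lambda>\<omega>. a * Z0 \<omega> + (\<Sum>m\<in>UNIV. s $ m * Z m \<omega>))"
      using mean_square_limit_lincomb[OF Z0 mean_square_limit_sum[of UNIV r Z "\<lambda>m. s $ m"], of a 1] Z by simp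
    have "a * R \<omega> + inner t (Y \<omega>) = (a * Z0 \<omega> + (\<Sum>m\<in>UNIV. s $ m * Z m \<omega>)) + inner s (\<epsilon> \<omega>)" for \<omega>
    proof -
      have "a * R \<omega> + inner t (Y \<omega>) = a * Z0 \<omega> + inner s (Y \<omega>)"
        unfolding R_def T_eq s_def by (simp add: inner_diff_left algebra_simps)
      then show ?thesis unfolding inner_Y by simp
    qed
    then have "(\<integral>\<omega>. iexp (a * R \<omega> + inner t (Y \<omega>)) \<partial>M) =
        exp (- (norm (a *\<^sub>R v0 + (\<Sum>m\<in>UNIV. s $ m *\<^sub>R r m)))\<^sup>2 / 2) * exp (- (lam * (norm s)\<^sup>2) / 2)"
      using mean_square_limit_fourier[OF lim indep[of _ s]] noise_facts(1)[of s] by simp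
    also have "\<dots> = exp (- q a t / 2)"
      unfolding q_def s_def[symmetric] by (simp add: exp_add[symmetric] field_simps flip: of_real_mult)
    finally show ?thesis .
  qed
  have "q (- a) t = q a t" for a t
  proof -
    define u where "u = v0 - (\<Sum>m\<in>UNIV. c $ m *\<^sub>R r m)"
    define w where "w = (\<Sum>m\<in>UNIV. t $ m *\<^sub>R r m)"
    have vec: "a *\<^sub>R v0 + (\<Sum>m\<in>UNIV. (t - a *\<^sub>R c) $ m *\<^sub>R r m) = w + a *\<^sub>R u" for a
      unfolding u_def w_def by (simp add: algebra_simps sum_subtractf scaleR_sum_right)
    have "inner w v0 = inner t b"
      unfolding w_def b_def by (simp add: inner_sum_left inner_vec_def inner_commute[of v0])
    also have "b = inner_gram r *v c + lam *\<^sub>R c" unfolding c_def by (rule ridge_coeffs_eq[OF lam, symmetric])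
    \<comment> \<open>the mixed term of \<open>q\<close> is \<open>2 * a * (inner w u - lam * inner t c)\<close>\<close>
    finally have "inner w u = lam * inner t c"
      unfolding u_def w_def[symmetric] inner_diff_right by (simp add: inner_add_right inner_inner_gram w_def)
    then show ?thesis
      unfolding q_def vec power2_norm_eq_inner by (simp add: inner_simps inner_commute algebra_simps)
  qed
  then have orth: "expectation (\<lambda>\<omega>. (Z0 \<omega> - T (Y \<omega>)) * indicator B (Y \<omega>)) = 0" if "B \<in> sets borel" for B
    using that unfolding R_def[symmetric]
    by (intro expectation_vimage_eq_0_of_even R_int Y_measurable) (simp_all only: fourier)
  note residual = Z0_measurable Y_measurable T_measurable Z0sq T2
  show "mmse_estimator M Z0 Y T" by (rule mmse_of_orthogonal_residual(1)[OF residual]) (rule orth)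
  show "cond_exp_given M Z0 Y T" by (rule mmse_of_orthogonal_residual(2)[OF residual]) (rule orth)
  show "AE \<omega> in M. S (Y \<omega>) = T (Y \<omega>)" if "mmse_estimator M Z0 Y S" for S
    by (rule mmse_of_orthogonal_residual(3)[OF residual _ that]) (rule orth)
qed

end

section \<open>Smoothing splines as optimal estimators\<close>

lemma gaussian_vector_inner:
  fixes \<epsilon> :: "'w \<Rightarrow> real ^ 'm::finite"
  assumes "gaussian_vector M UNIV (\<lambda>m \<omega>. \<epsilon> \<omega> $ m) (\<lambda>m n. if m = n then v else 0)"
  shows "\<epsilon> \<in> borel_measurable M"
    and "distr M borel (\<lambda>\<omega>. inner s (\<epsilon> \<omega>)) = centered_gaussian (v * (norm s)\<^sup>2)"
proof -
  have [measurable]: "(\<lambda>\<omega>. \<epsilon> \<omega> $ m) \<in> borel_measurable M" for m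
    using assms unfolding gaussian_vector_def by auto
  show "\<epsilon> \<in> borel_measurable M"
    by (subst borel_measurable_euclidean_space) (auto simp: Basis_vec_def inner_axis)
  have "(\<Sum>i\<in>UNIV. \<Sum>k\<in>UNIV. s $ i * s $ k * (if i = k then v else 0)) = v * (norm s)\<^sup>2"
  proof -
    have "(\<Sum>i\<in>UNIV. \<Sum>k\<in>UNIV. s $ i * s $ k * (if i = k then v else 0)) =
        (\<Sum>i\<in>UNIV. \<Sum>k\<in>UNIV. if i = k then v * (s $ i * s $ k) else 0)"
      by (intro sum.cong) auto
    then show ?thesis unfolding power2_norm_eq_inner inner_vec_def by (simp add: sum_distrib_left)
  qed
  moreover have "distr M borel (\<lambda>\<omega>. \<Sum>i\<in>UNIV. s $ i * \<epsilon> \<omega> $ i) =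
      centered_gaussian (\<Sum>i\<in>UNIV. \<Sum>k\<in>UNIV. s $ i * s $ k * (if i = k then v else 0))"
    using assms unfolding gaussian_vector_def by blast
  ultimately show "distr M borel (\<lambda>\<omega>. inner s (\<epsilon> \<omega>)) = centered_gaussian (v * (norm s)\<^sup>2)"
    by (simp add: inner_vec_def)
qed

lemma measurable_pr_cylinder: "(\<lambda>u. pr u \<phi>) \<in> borel_measurable (cylinder_algebra pr)"
proof -
  have "pr \<in> measurable (cylinder_algebra pr) (PiM UNIV (\<lambda>_. borel))"
    unfolding cylinder_algebra_def by (rule measurable_vimage_algebra1) (auto simp: space_PiM)
  from measurable_compose[OF this measurable_component_singleton[of \<phi>]] show ?thesis by simp
qed

lemma sigma_sets_vimage_subset_vimage_algebra:
  assumes F: "F \<in> measurable M S" and g: "g \<in> measurable S S'"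
  shows "sigma_sets (space M) {(\<lambda>\<omega>. g (F \<omega>)) -` A \<inter> space M |A. A \<in> sets S'} \<subseteq> sets (vimage_algebra (space M) F S)"
proof -
  have "F \<in> space M \<rightarrow> space S" using F by (auto simp: measurable_def)
  then have m: "(\<lambda>\<omega>. g (F \<omega>)) \<in> measurable (vimage_algebra (space M) F S) S'"
    by (intro measurable_compose[OF measurable_vimage_algebra1 g])
  have "{(\<lambda>\<omega>. g (F \<omega>)) -` A \<inter> space M |A. A \<in> sets S'} \<subseteq> sets (vimage_algebra (space M) F S)"
    using measurable_sets[OF m] by auto
  from sets.sigma_sets_subset[OF this] show ?thesis by simp
qed

lemma (in prob_space) indep_var_of_indep_vimage_algebras:
  assumes G: "G \<in> measurable M P" and H: "H \<in> measurable M Q"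
    and indep: "indep_set (sets (vimage_algebra (space M) G P)) (sets (vimage_algebra (space M) H Q))"
    and f: "f \<in> measurable P P'" and h: "h \<in> measurable Q Q'"
  shows "indep_var P' (\<lambda>\<omega>. f (G \<omega>)) Q' (\<lambda>\<omega>. h (H \<omega>))"
proof -
  note sub = sigma_sets_vimage_subset_vimage_algebra[OF G f] sigma_sets_vimage_subset_vimage_algebra[OF H h]
  have "indep_set (sigma_sets (space M) {(\<lambda>\<omega>. f (G \<omega>)) -` A \<inter> space M |A. A \<in> sets P'})
      (sigma_sets (space M) {(\<lambda>\<omega>. h (H \<omega>)) -` A \<inter> space M |A. A \<in> sets Q'})"
    using indep sub unfolding indep_sets2_eq by (meson subset_iff)
  then show ?thesis
    unfolding indep_var_eq using measurable_compose[OF G f] measurable_compose[OF H h] by blast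
qed

text \<open>
  The process \<open>\<phi> \<mapsto> pr (G \<omega>) \<phi>\<close> is Gaussian with \<open>K = L\<^sup>-\<^sup>1\<^sup>*\<close>, and its extension \<open>Gext \<nu>\<close> is the mean-square
  limit at the representer of \<open>\<nu>\<close>. So the statistical part is the ridge predictor and the variational part
  is the ridge regression, both for the representers of the measurement functionals.
\<close>

theorem theorem7:
  fixes pr :: "'d::{real_vector,topological_ab_group_add,t2_space}
                 \<Rightarrow> 's::{real_vector,topological_ab_group_add,t2_space} \<Rightarrow> real"
    and emb A :: "'s \<Rightarrow> 'd"
    and j L :: "'s \<Rightarrow> 'l::{real_inner,complete_space}"
    and Linv :: "'l \<Rightarrow> 'd"
    and M :: "'w measure"
    and G :: "'w \<Rightarrow> 'd"
    and Gext :: "'d \<Rightarrow> 'w \<Rightarrow> real"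
    and \<nu> :: "'m::finite \<Rightarrow> 'd"
    and \<epsilon> Y :: "'w \<Rightarrow> real ^ 'm"
    and \<sigma> :: real
  assumes "nuclear_dual_pair pr emb"
    and "pivot_space pr emb j"
    and "invertible_operator pr emb j L Linv"
    and "A = gram_op pr Linv"
    and "gaussian_process M pr A G"
    and "process_extension M pr emb L G Gext"
    and "\<And>m. \<nu> m \<in> native_dual pr L"
    and "inj \<nu>" and "independent (range \<nu>)"
    and "\<sigma> > 0"
    and "gaussian_vector M UNIV (\<lambda>m \<omega>. \<epsilon> \<omega> $ m) (\<lambda>m n. if m = n then \<sigma>\<^sup>2 else 0)"
    and "prob_space.indep_set M (sets (vimage_algebra (space M) G (cylinder_algebra pr)))
                                (sets (vimage_algebra (space M) \<epsilon> borel))"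
    and "Y = (\<lambda>\<omega>. (\<chi> m. Gext (\<nu> m) \<omega>) + \<epsilon> \<omega>)"
  shows "range emb \<subseteq> native_dual pr L \<and>
     (\<forall>\<phi>\<in>native_dual pr L.
        mmse_estimator M (Gext \<phi>) Y
          (\<lambda>y. native_pairing pr emb L \<phi> (smoothing_spline pr emb L \<nu> (\<sigma>\<^sup>2) y)) \<and>
        (\<forall>T. mmse_estimator M (Gext \<phi>) Y T \<longrightarrow>
           (AE \<omega> in M. T (Y \<omega>) =
              native_pairing pr emb L \<phi> (smoothing_spline pr emb L \<nu> (\<sigma>\<^sup>2) (Y \<omega>)))) \<and>
        cond_exp_given M (Gext \<phi>) Y
          (\<lambda>y. native_pairing pr emb L \<phi> (smoothing_spline pr emb L \<nu> (\<sigma>\<^sup>2) y))) \<and>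
     (\<forall>lam>0. \<forall>y.
        {g. is_arg_min (spline_cost pr emb L \<nu> lam y) (\<lambda>g. g \<in> native_space emb L) g}
          = {smoothing_spline pr emb L \<nu> lam y} \<and>
        invertible (gram_matrix pr emb L A \<nu> + lam *\<^sub>R mat 1) \<and>
        smoothing_spline pr emb L \<nu> lam y =
          (\<Sum>m\<in>UNIV. (matrix_inv (gram_matrix pr emb L A \<nu> + lam *\<^sub>R mat 1) *v y) $ m
                       *\<^sub>R ext_gram pr emb L A (\<nu> m)))"
proof -
  interpret native_setting pr emb j L Linv
    by (intro native_setting.intro assms(1-3))
  interpret prob_space M using assms(5) unfolding gaussian_process_def by blast
  define K where "K = inv_adjoint pr Linv"
  define X where "X \<phi> \<omega> = pr (G \<omega>) \<phi>" for \<phi> \<omega>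
  have G: "G \<in> measurable M (cylinder_algebra pr)"
    using assms(5) unfolding gaussian_process_def by blast
  have X_meas: "X \<phi> \<in> borel_measurable M" for \<phi>
    unfolding X_def[abs_def] by (rule measurable_compose[OF G measurable_pr_cylinder])
  have X_law: "distr M borel (X \<phi>) = centered_gaussian ((norm (K \<phi>))\<^sup>2)" for \<phi>
  proof -
    \<comment> \<open>the marginal law of a single variable, read off with the coefficient \<open>1\<close>\<close>
    have "gaussian_vector M {..<1::nat} (\<lambda>n \<omega>. pr (G \<omega>) \<phi>) (\<lambda>m n. pr (A \<phi>) \<phi>)"
      using assms(5)[unfolded gaussian_process_def, THEN conjunct2, THEN conjunct2, THEN spec[of _ 1], THEN spec[of _ "\<lambda>_. \<phi>"]] .
    then have "distr M borel (\<lambda>\<omega>. \<Sum>i<1::nat. 1 * pr (G \<omega>) \<phi>) =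
        centered_gaussian (\<Sum>i<1::nat. \<Sum>k<1::nat. 1 * 1 * pr (A \<phi>) \<phi>)"
      unfolding gaussian_vector_def by (elim conjE allE[of _ "\<lambda>_. 1"])
    then show ?thesis
      unfolding assms(4) X_def[abs_def] K_def power2_norm_eq_inner by (simp add: gram_op_eq)
  qed
  interpret linear_gaussian_process M X K
  proof (intro linear_gaussian_process.intro linear_gaussian_process_axioms.intro prob_space_axioms X_meas X_law)
    show "linear K" unfolding K_def by (rule linear_inv_adjoint)
    show "linear (\<lambda>\<phi>. X \<phi> \<omega>)" for \<omega> unfolding X_def by (rule linear_pr)
  qed
  have limit: "mean_square_limit (representer \<phi>) (Gext \<phi>)" if \<phi>: "\<phi> \<in> native_dual pr L" for \<phi>
  proof -
    have "representer \<phi> \<in> closure (range K)" unfolding K_def dense_range_inv_adjoint by simp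
    then obtain x where x: "\<And>n. x n \<in> range K" "x \<longlonglongrightarrow> representer \<phi>"
      unfolding closure_sequential by auto
    have "\<forall>n. \<exists>p. x n = K p" using x(1) by blast
    from choice[OF this] obtain \<psi> where "x = (\<lambda>n. K (\<psi> n))" by auto
    with x(2) have \<psi>: "(\<lambda>n. K (\<psi> n)) \<longlonglongrightarrow> representer \<phi>" by simp
    have "((\<lambda>\<psi>. expectation (\<lambda>\<omega>. (X \<psi> \<omega> - Gext \<phi> \<omega>)\<^sup>2)) \<longlongrightarrow> 0) (filtercomap K (nhds (representer \<phi>)))"
      unfolding X_def K_def to_dual_eq[OF \<phi>, symmetric] using assms(6) \<phi> unfolding process_extension_def by blast
    moreover have "filterlim \<psi> (filtercomap K (nhds (representer \<phi>))) sequentially"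
      using \<psi> by (simp add: filterlim_filtercomap_iff comp_def)
    ultimately have "(\<lambda>n. expectation (\<lambda>\<omega>. (X (\<psi> n) \<omega> - Gext \<phi> \<omega>)\<^sup>2)) \<longlonglongrightarrow> 0"
      by (rule filterlim_compose)
    with \<psi> have "\<exists>\<psi>. (\<lambda>n. K (\<psi> n)) \<longlonglongrightarrow> representer \<phi> \<and>
        (\<lambda>n. expectation (\<lambda>\<omega>. (X (\<psi> n) \<omega> - Gext \<phi> \<omega>)\<^sup>2)) \<longlonglongrightarrow> 0" by blast
    moreover have "Gext \<phi> \<in> borel_measurable M" "integrable M (\<lambda>\<omega>. (Gext \<phi> \<omega>)\<^sup>2)"
      using assms(6) \<phi> unfolding process_extension_def by blast+
    ultimately show ?thesis unfolding mean_square_limit_def by blast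
  qed
  define r where "r m = representer (\<nu> m)" for m
  have lam: "\<sigma>\<^sup>2 > 0" using assms(10) by simp
  note noise = gaussian_vector_inner[OF assms(11)]
  have indep: "indep_var borel (X \<phi>) borel (\<lambda>\<omega>. inner s (\<epsilon> \<omega>))" for \<phi> s
    unfolding X_def[abs_def]
    by (rule indep_var_of_indep_vimage_algebras[OF G noise(1) assms(12) measurable_pr_cylinder]) measurable
  have spline: "smoothing_spline pr emb L \<nu> lam y = Linv (\<Sum>m\<in>UNIV. ridge_coeffs r lam y $ m *\<^sub>R r m)"
    if "lam > 0" for lam y
    unfolding r_def[abs_def] by (rule smoothing_spline_eq[OF assms(7) that])
  have estimate: "native_pairing pr emb L \<phi> (smoothing_spline pr emb L \<nu> (\<sigma>\<^sup>2) y) =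
      inner (representer \<phi>) (\<Sum>m\<in>UNIV. ridge_coeffs r (\<sigma>\<^sup>2) y $ m *\<^sub>R r m)"
    if "\<phi> \<in> native_dual pr L" for \<phi> y
    unfolding spline[OF lam] native_pairing_eq[OF that] ..
  have "range emb \<subseteq> native_dual pr L" using emb_in_native_dual by auto
  moreover have "mmse_estimator M (Gext \<phi>) Y
          (\<lambda>y. native_pairing pr emb L \<phi> (smoothing_spline pr emb L \<nu> (\<sigma>\<^sup>2) y)) \<and>
        (\<forall>T. mmse_estimator M (Gext \<phi>) Y T \<longrightarrow>
           (AE \<omega> in M. T (Y \<omega>) =
              native_pairing pr emb L \<phi> (smoothing_spline pr emb L \<nu> (\<sigma>\<^sup>2) (Y \<omega>)))) \<and>
        cond_exp_given M (Gext \<phi>) Y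
          (\<lambda>y. native_pairing pr emb L \<phi> (smoothing_spline pr emb L \<nu> (\<sigma>\<^sup>2) y))"
    if \<phi>: "\<phi> \<in> native_dual pr L" for \<phi>
  proof -
    have "mean_square_limit (r m) (Gext (\<nu> m))" for m unfolding r_def by (rule limit[OF assms(7)])
    note predictor = ridge_predictor_mmse[where r = r and Z = "\<lambda>m. Gext (\<nu> m)",
        OF this limit[OF \<phi>] lam noise indep]
    show ?thesis
      unfolding estimate[OF \<phi>] assms(13) by (intro conjI allI impI predictor(1,2)) (rule predictor(3))
  qed
  moreover have "{g. is_arg_min (spline_cost pr emb L \<nu> lam y) (\<lambda>g. g \<in> native_space emb L) g}
          = {smoothing_spline pr emb L \<nu> lam y} \<and>
        invertible (gram_matrix pr emb L A \<nu> + lam *\<^sub>R mat 1) \<and>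
        smoothing_spline pr emb L \<nu> lam y =
          (\<Sum>m\<in>UNIV. (matrix_inv (gram_matrix pr emb L A \<nu> + lam *\<^sub>R mat 1) *v y) $ m
                       *\<^sub>R ext_gram pr emb L A (\<nu> m))" if "lam > 0" for lam y
  proof (intro conjI)
    have gram: "gram_matrix pr emb L A \<nu> = inner_gram r"
      unfolding assms(4) r_def[abs_def] by (rule gram_matrix_eq[OF assms(7)])
    show "{g. is_arg_min (spline_cost pr emb L \<nu> lam y) (\<lambda>g. g \<in> native_space emb L) g}
          = {smoothing_spline pr emb L \<nu> lam y}"
      unfolding spline_cost_minimizers[OF assms(7) that] spline[OF that] r_def[abs_def] by simp
    show "invertible (gram_matrix pr emb L A \<nu> + lam *\<^sub>R mat 1)"
      unfolding gram by (rule invertible_regularized_gram[OF that])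
    show "smoothing_spline pr emb L \<nu> lam y =
          (\<Sum>m\<in>UNIV. (matrix_inv (gram_matrix pr emb L A \<nu> + lam *\<^sub>R mat 1) *v y) $ m
                       *\<^sub>R ext_gram pr emb L A (\<nu> m))"
      unfolding gram spline[OF that] ridge_coeffs_def[symmetric]
      unfolding assms(4) ext_gram_eq[OF assms(7)] r_def[symmetric]
      by (simp add: linear_sum[OF linear_Linv] linear_scale[OF linear_Linv])
  qed
  ultimately show ?thesis by blast
qed

end
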